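(* Let $A$ be a local ring with maximal ideal $\mathfrak{m}$, $M$ a finitely generated $A$-module, and $a_1,\ldots,a_r$ ($r\ge 1$) a system of parameters of $M$; put $\mathfrak{q}=(a_1,\ldots,a_r)$. Then $$l(M/\mathfrak{q}^{n+1}M)\le\sum_{i=0}^{r}\binom{n+r-i}{r-i}e_i(\mathfrak{q};M)$$ for all $n\ge 0$. Equality holds for an infinite sequence of integers $n\ge 0$ if and only if $a_1,\ldots,a_r$ is an absolutely superficial $M$-sequence.
   Context: Local rings are commutative and Noetherian; $l(\cdot)$ denotes length. For a submodule $N$ of a module $L$ and $a\in A$, $N:a=\{x\in L: ax\in N\}$; $O_M$ is the zero submodule of $M$. For $a_1,\ldots,a_r\in\mathfrak{m}$ put $\mathfrak{q}_i=(a_1,\ldots,a_i)$, $\mathfrak{q}_0=0$, $\mathfrak{q}=\mathfrak{q}_r$. The integers $e_i(\mathfrak{q};M)$ (which depend on the sequence $a_1,\ldots,a_r$) are defined by $$e_0(\mathfrak{q};M)=l(M/\mathfrak{q}M)-l\big((\mathfrak{q}_{r-1}M:a_r)/((\mathfrak{q}_{r-1}M:a_r)\cap\mathfrak{q}M)\big),$$ $$e_i(\mathfrak{q};M)=l\big((\mathfrak{q}_{r-i}M:a_{r-i+1})/((\mathfrak{q}_{r-i}M:a_{r-i+1})\cap\mathfrak{q}M)\big)-l\big((\mathfrak{q}_{r-i-1}M:a_{r-i})/((\mathfrak{q}_{r-i-1}M:a_{r-i})\cap\mathfrak{q}M)\big)\quad(0<i<r),$$ $$e_r(\mathfrak{q};M)=l\big((O_M:a_1)/((O_M:a_1)\cap\mathfrak{q}M)\big).$$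 The sequence $a_1,\ldots,a_r$ is an absolutely superficial $M$-sequence if for each $i=1,\ldots,r$, with $M_{i-1}:=M/\mathfrak{q}_{i-1}M$, one has $(\mathfrak{q}^{n+1}M_{i-1}:a_i)\cap\mathfrak{q}M_{i-1}=\mathfrak{q}^nM_{i-1}$ for all sufficiently large $n$. *)

theory Defs
  imports
    "HOL-Library.Extended_Real"
    "HOL-Algebra.QuotRing"
    "HOL-Algebra.Ideal_Product"
    "HOL-Algebra.Ring_Divisibility"
    "HOL-Algebra.Module"
begin

section \<open>Local rings and Krull dimension\<close>

locale noetherian_local_ring = cring R + noetherian_ring R for R (structure) +
  fixes \<mm> :: "'a set"
  assumes maximal: "maximalideal \<mm> R"
    and unique_maximal: "maximalideal J R \<Longrightarrow> J = \<mm>"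

text \<open>
  A chain of \<open>n + 1\<close> prime ideals counts as \<open>n\<close>. The supremum is taken in \<^typ>\<open>enat\<close>, so the
  zero ring, which has no prime ideal, gets dimension \<open>0\<close> rather than \<open>-\<infinity>\<close>.
\<close>
definition krull_dim :: "('a, 'r) ring_scheme \<Rightarrow> enat"
  where "krull_dim R = Sup {enat n | n. \<exists>P :: nat \<Rightarrow> 'a set.
    (\<forall>i\<le>n. primeideal (P i) R) \<and> (\<forall>i<n. P i \<subset> P (Suc i))}"


section \<open>Submodules, quotient modules, length\<close>

definition submodule_gen ::
    "('a, 'r) ring_scheme \<Rightarrow> ('a, 'b, 'm) module_scheme \<Rightarrow> 'b set \<Rightarrow> 'b set"
  where "submodule_gen R M S = \<Inter>{N. submodule N R M \<and> S \<subseteq> N}"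

definition fin_gen_module :: "('a, 'r) ring_scheme \<Rightarrow> ('a, 'b, 'm) module_scheme \<Rightarrow> bool"
  where "fin_gen_module R M \<longleftrightarrow>
    (\<exists>S. finite S \<and> S \<subseteq> carrier M \<and> submodule_gen R M S = carrier M)"

definition annihilator :: "('a, 'r) ring_scheme \<Rightarrow> ('a, 'b, 'm) module_scheme \<Rightarrow> 'a set"
  where "annihilator R M = {c \<in> carrier R. \<forall>x\<in>carrier M. c \<odot>\<^bsub>M\<^esub> x = \<zero>\<^bsub>M\<^esub>}"

definition module_dim :: "('a, 'r) ring_scheme \<Rightarrow> ('a, 'b, 'm) module_scheme \<Rightarrow> enat"
  where "module_dim R M = krull_dim (R Quot annihilator R M)"

text \<open>The submodule \<open>IM\<close>.\<close>
definition ideal_smult ::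
    "('a, 'r) ring_scheme \<Rightarrow> ('a, 'b, 'm) module_scheme \<Rightarrow> 'a set \<Rightarrow> 'b set"
  where "ideal_smult R M I = submodule_gen R M {c \<odot>\<^bsub>M\<^esub> x | c x. c \<in> I \<and> x \<in> carrier M}"

text \<open>The submodule \<open>N : a\<close> of \<open>M\<close>.\<close>
definition colon :: "('a, 'b, 'm) module_scheme \<Rightarrow> 'b set \<Rightarrow> 'a \<Rightarrow> 'b set"
  where "colon M N a = {x \<in> carrier M. a \<odot>\<^bsub>M\<^esub> x \<in> N}"

text \<open>
  The quotient \<open>M/N\<close>, with the cosets of \<open>N\<close> as elements. The fields \<^const>\<open>monoid.mult\<close> and \<^const>\<open>one\<close>
  that a module record inherits from rings play no role in \<^locale>\<open>module\<close>.
\<close>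
definition quot_module :: "('a, 'b, 'm) module_scheme \<Rightarrow> 'b set \<Rightarrow> ('a, 'b set) module"
  where "quot_module M N =
    \<lparr>carrier = a_rcosets\<^bsub>M\<^esub> N, monoid.mult = undefined, one = undefined, zero = N, add = set_add M,
     smult = (\<lambda>c C. \<Union>x\<in>C. N +>\<^bsub>M\<^esub> (c \<odot>\<^bsub>M\<^esub> x))\<rparr>"

definition module_length :: "('a, 'r) ring_scheme \<Rightarrow> ('a, 'b, 'm) module_scheme \<Rightarrow> enat"
  where "module_length R M = Sup {enat n | n. \<exists>N :: nat \<Rightarrow> 'b set.
    (\<forall>i\<le>n. submodule (N i) R M) \<and> (\<forall>i<n. N i \<subset> N (Suc i))}"

text \<open>\<open>l(N/L)\<close> for submodules \<open>L \<subseteq> N\<close> of \<open>M\<close>.\<close>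
definition subquot_length ::
    "('a, 'r) ring_scheme \<Rightarrow> ('a, 'b, 'm) module_scheme \<Rightarrow> 'b set \<Rightarrow> 'b set \<Rightarrow> enat"
  where "subquot_length R M N L = module_length R (quot_module (M\<lparr>carrier := N\<rparr>) L)"


section \<open>Systems of parameters and absolutely superficial sequences\<close>

text \<open>
  A sequence \<open>a\<^sub>1, \<dots>, a\<^sub>r\<close> is a function \<open>a\<close> on \<^typ>\<open>nat\<close> of which only the values at \<open>1, \<dots>, r\<close>
  are used.
\<close>

definition seq_ideal :: "('a, 'r) ring_scheme \<Rightarrow> (nat \<Rightarrow> 'a) \<Rightarrow> nat \<Rightarrow> 'a set"
  where "seq_ideal R a i = Idl\<^bsub>R\<^esub> (a ` {1..i})"

definition system_of_parameters ::
    "('a, 'r) ring_scheme \<Rightarrow> 'a set \<Rightarrow> ('a, 'b, 'm) module_scheme \<Rightarrow> nat \<Rightarrow> (nat \<Rightarrow> 'a) \<Rightarrow> bool"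
  where "system_of_parameters R \<mm> M r a \<longleftrightarrow>
    module_dim R M = enat r \<and> (\<forall>i\<in>{1..r}. a i \<in> \<mm>) \<and>
    module_length R (quot_module M (ideal_smult R M (seq_ideal R a r))) < \<infinity>"

definition absolutely_superficial ::
    "('a, 'r) ring_scheme \<Rightarrow> ('a, 'b, 'm) module_scheme \<Rightarrow> nat \<Rightarrow> (nat \<Rightarrow> 'a) \<Rightarrow> bool"
  where "absolutely_superficial R M r a \<longleftrightarrow>
    (let q = seq_ideal R a r in
     \<forall>i\<in>{1..r}.
       let L = quot_module M (ideal_smult R M (seq_ideal R a (i - 1))) in
       \<forall>\<^sub>F n in sequentially.
         colon L (ideal_smult R L (q [^]\<^bsub>ideals_set R\<^esub> (n + 1))) (a i) \<inter> ideal_smult R L q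
           = ideal_smult R L (q [^]\<^bsub>ideals_set R\<^esub> n))"

text \<open>
  \<open>l((N : c)/((N : c) \<inter> \<qq>M))\<close>, where \<open>Q\<close> stands for \<open>\<qq>M\<close>. As a submodule of \<open>M/\<qq>M\<close> it
  has finite length when \<open>a\<^sub>1, \<dots>, a\<^sub>r\<close> is a system of parameters, so \<^const>\<open>the_enat\<close> is harmless
  here and in the next definition.
\<close>
definition colon_length ::
    "('a, 'r) ring_scheme \<Rightarrow> ('a, 'b, 'm) module_scheme \<Rightarrow> 'b set \<Rightarrow> 'b set \<Rightarrow> 'a \<Rightarrow> int"
  where "colon_length R M Q N c = int (the_enat (subquot_length R M (colon M N c) (colon M N c \<inter> Q)))"

definition e_coeff ::
    "('a, 'r) ring_scheme \<Rightarrow> ('a, 'b, 'm) module_scheme \<Rightarrow> nat \<Rightarrow> (nat \<Rightarrow> 'a) \<Rightarrow> nat \<Rightarrow> int"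
  where "e_coeff R M r a i =
    (let QM = (\<lambda>j. ideal_smult R M (seq_ideal R a j)) in
     if i = 0 then
       int (the_enat (module_length R (quot_module M (QM r))))
         - colon_length R M (QM r) (QM (r - 1)) (a r)
     else if i < r then
       colon_length R M (QM r) (QM (r - i)) (a (r - i + 1))
         - colon_length R M (QM r) (QM (r - i - 1)) (a (r - i))
     else colon_length R M (QM r) {\<zero>\<^bsub>M\<^esub>} (a 1))"

end

theory Submission
  imports Defs
begin

text \<open>
  Put \<open>h\<^sub>i(n) = l(M/(\<qq>\<^sub>iM + \<qq>\<^sup>nM))\<close>. Multiplication by \<open>a\<^sub>i\<^sub>+\<^sub>1\<close> on \<open>M/(\<qq>\<^sub>iM + \<qq>\<^sup>nM)\<close> gives
  \<open>h\<^sub>i(n+1) - h\<^sub>i(n) = h\<^sub>i\<^sub>+\<^sub>1(n+1) - d\<^sub>i(n)\<close>, where \<open>d\<^sub>i(n)\<close> is the length of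
  \<open>((\<qq>\<^sub>iM + \<qq>\<^sup>n\<^sup>+\<^sup>1M) : a\<^sub>i\<^sub>+\<^sub>1)/(\<qq>\<^sub>iM + \<qq>\<^sup>nM)\<close>, and for \<open>n \<ge> 1\<close> this is at least the number \<open>c\<^sub>i\<close>
  from which the \<open>e\<^sub>j\<close> are formed. The polynomial in the theorem solves the recursion with every
  \<open>d\<^sub>i(n)\<close> replaced by \<open>c\<^sub>i\<close>. Its excess over \<open>h\<^sub>0\<close> is therefore nonnegative and nondecreasing, and
  vanishes infinitely often iff \<open>d\<^sub>i(n) = c\<^sub>i\<close> for all \<open>i\<close> and all \<open>n \<ge> 1\<close>. This condition contains
  absolute superficiality. Conversely, by Krull's intersection theorem superficiality gives
  \<open>(\<qq>\<^sub>iM : a\<^sub>i\<^sub>+\<^sub>1) \<inter> \<qq>M = \<qq>\<^sub>iM\<close>, the condition defining a d-sequence; then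
  \<open>\<qq>\<^sub>iM \<inter> \<qq>\<^sup>n\<^sup>+\<^sup>1M = \<qq>\<^sub>i\<qq>\<^sup>nM\<close>, hence
  \<open>(\<qq>\<^sub>iM + \<qq>\<^sup>n\<^sup>+\<^sup>1M) : a\<^sub>i\<^sub>+\<^sub>1 = (\<qq>\<^sub>iM : a\<^sub>i\<^sub>+\<^sub>1) + \<qq>\<^sup>nM\<close> for all \<open>n\<close>, which forces \<open>d\<^sub>i(n) = c\<^sub>i\<close>.
\<close>

section \<open>Lengths of chains\<close>

text \<open>Arbitrary families of sets are allowed, so that lengths of quotient modules and of
  intervals of submodules can be compared through strictly monotone maps between families.\<close>

definition has_chain :: "'a set set \<Rightarrow> nat \<Rightarrow> bool"
  where "has_chain F n \<longleftrightarrow> (\<exists>N. (\<forall>i\<le>n. N i \<in> F) \<and> (\<forall>i<n. N i \<subset> N (Suc i)))"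

definition chain_length :: "'a set set \<Rightarrow> enat"
  where "chain_length F = Sup {enat n | n. has_chain F n}"

lemma has_chain_le_length: "has_chain F n \<Longrightarrow> enat n \<le> chain_length F"
  unfolding chain_length_def by (rule Sup_upper) auto

lemma has_chain_antimono:
  assumes "has_chain F n" "m \<le> n"
  shows "has_chain F m"
proof -
  obtain N where "\<forall>i\<le>n. N i \<in> F" "\<forall>i<n. N i \<subset> N (Suc i)"
    using assms(1) unfolding has_chain_def by blast
  then show ?thesis
    unfolding has_chain_def using assms(2) by (intro exI[of _ N]) auto
qed

text \<open>Chains can be truncated, so if length \<open>k\<close> is missed then every chain is
  shorter and the supremum is at most \<open>k - 1\<close>. For empty \<open>F\<close> the supremum
  is 0 although there is no chain of length 0.\<close>

lemma enat_le_chain_length_iff: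
  assumes "F \<noteq> {}"
  shows "enat k \<le> chain_length F \<longleftrightarrow> has_chain F k"
proof
  assume le: "enat k \<le> chain_length F"
  show "has_chain F k"
  proof (rule ccontr)
    assume no: "\<not> has_chain F k"
    obtain X where "X \<in> F" using assms by auto
    then have "has_chain F 0" by (auto simp: has_chain_def)
    then obtain k' where k: "k = Suc k'" using no by (cases k) auto
    have "chain_length F \<le> enat k'"
      unfolding chain_length_def
    proof (rule Sup_least)
      fix x assume "x \<in> {enat n | n. has_chain F n}"
      then obtain n where n: "x = enat n" "has_chain F n" by blast
      then have "n < k" using has_chain_antimono no not_le by blast
      then show "x \<le> enat k'" using n k by simp
    qed
    then show False using le k by (metis enat_ord_simps(1) not_less_eq_eq order.refl order.trans)
  qed
qed (rule has_chain_le_length)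

lemma enat_leI:
  fixes x y :: enat
  assumes "\<And>k. enat k \<le> x \<Longrightarrow> enat k \<le> y"
  shows "x \<le> y"
proof (cases x)
  case (enat m)
  then show ?thesis using assms by simp
next
  case infinity
  then show ?thesis using assms by (cases y) (auto dest: spec[of _ "Suc _"], metis Suc_n_not_le_n)
qed

text \<open>Reduces a bound on a sum of possibly infinite lengths to joining two finite
  chains.\<close>

lemma enat_add_leI:
  fixes x y z :: enat
  assumes "\<And>k l. enat k \<le> x \<Longrightarrow> enat l \<le> y \<Longrightarrow> enat (k + l) \<le> z"
  shows "x + y \<le> z"
proof (rule enat_leI)
  fix k assume k: "enat k \<le> x + y"
  show "enat k \<le> z"
  proof (cases x)
    case (enat m)
    show ?thesis
    proof (cases "k \<le> m")
      case True
      then show ?thesis using assms[of k 0] enat by (simp add: zero_enat_def[symmetric])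
    next
      case False
      then have "enat (k - m) \<le> y" using k enat by (cases y) auto
      then show ?thesis using assms[of m "k - m"] enat False by simp
    qed
  next
    case infinity
    then show ?thesis using assms[of k 0] by (simp add: zero_enat_def[symmetric])
  qed
qed

lemma chain_length_mono_map:
  assumes "\<And>X. X \<in> F \<Longrightarrow> f X \<in> G"
    and "\<And>X Y. X \<in> F \<Longrightarrow> Y \<in> F \<Longrightarrow> X \<subset> Y \<Longrightarrow> f X \<subset> f Y"
  shows "chain_length F \<le> chain_length G"
  unfolding chain_length_def
proof (rule Sup_subset_mono, rule subsetI)
  fix x assume "x \<in> {enat n | n. has_chain F n}"
  then obtain n N where "x = enat n" and N: "\<forall>i\<le>n. N i \<in> F" "\<forall>i<n. N i \<subset> N (Suc i)"
    by (auto simp: has_chain_def)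
  moreover have "has_chain G n"
    unfolding has_chain_def using N assms by (intro exI[of _ "\<lambda>i. f (N i)"]) auto
  ultimately show "x \<in> {enat n | n. has_chain G n}" by blast
qed

text \<open>Deleting repetitions from a weakly increasing sequence leaves one strict step for each
  change of value.\<close>

lemma has_chain_strict_steps:
  assumes "\<forall>i\<le>n. T i \<in> F" "\<forall>i<n. T i \<subseteq> T (Suc i)"
  shows "has_chain F (card {i. i < n \<and> T i \<noteq> T (Suc i)})"
proof -
  \<comment> \<open>The induction also fixes the top of the chain at \<open>T n\<close>, which is
    where the next member is appended.\<close>
  have "\<exists>N. (\<forall>i \<le> card {i. i < n \<and> T i \<noteq> T (Suc i)}. N i \<in> F)
    \<and> (\<forall>i < card {i. i < n \<and> T i \<noteq> T (Suc i)}. N i \<subset> N (Suc i))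
    \<and> N (card {i. i < n \<and> T i \<noteq> T (Suc i)}) = T n"
    using assms
  proof (induction n)
    case 0
    then show ?case by auto
  next
    case (Suc n)
    let ?c = "card {i. i < n \<and> T i \<noteq> T (Suc i)}"
    obtain N where N: "\<forall>i\<le>?c. N i \<in> F" "\<forall>i<?c. N i \<subset> N (Suc i)" "N ?c = T n"
      using Suc by auto
    show ?case
    proof (cases "T n = T (Suc n)")
      case True
      then have "{i. i < Suc n \<and> T i \<noteq> T (Suc i)} = {i. i < n \<and> T i \<noteq> T (Suc i)}"
        by (auto simp: less_Suc_eq)
      then show ?thesis using N True by auto
    next
      case False
      then have "{i. i < Suc n \<and> T i \<noteq> T (Suc i)} = insert n {i. i < n \<and> T i \<noteq> T (Suc i)}"
        by (auto simp: less_Suc_eq)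
      then have c: "card {i. i < Suc n \<and> T i \<noteq> T (Suc i)} = Suc ?c" by simp
      have "T n \<subset> T (Suc n)" using False Suc.prems by auto
      then show ?thesis
        unfolding c using N Suc.prems(1)
        by (intro exI[of _ "N(Suc ?c := T (Suc n))"]) (auto simp: less_Suc_eq le_Suc_eq)
    qed
  qed
  then show ?thesis unfolding has_chain_def by blast
qed

lemma module_length_chain_length: "module_length R M = chain_length {N. submodule N R M}"
  unfolding module_length_def chain_length_def has_chain_def by simp


section \<open>The lattice of submodules\<close>

context module
begin

abbreviation sub :: "'c set \<Rightarrow> bool"
  where "sub N \<equiv> submodule N R M"

lemmas sub_carrier = carrier_is_submodule

lemma sub_in_carrier: "sub N \<Longrightarrow> x \<in> N \<Longrightarrow> x \<in> carrier M"
  using submoduleE(1) by blast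

lemma sub_zero: "sub N \<Longrightarrow> \<zero>\<^bsub>M\<^esub> \<in> N"
  by (metis submoduleE(1) submoduleE(2) submoduleE(4) R.zero_closed smult_l_null subset_iff ex_in_conv)

lemma sub_minus: "sub N \<Longrightarrow> x \<in> N \<Longrightarrow> y \<in> N \<Longrightarrow> x \<ominus>\<^bsub>M\<^esub> y \<in> N"
  by (simp add: a_minus_def submoduleE)

lemma sub_add_cancel:
  assumes "sub N" "x \<oplus>\<^bsub>M\<^esub> y \<in> N" "x \<in> carrier M" "y \<in> carrier M"
  shows "x \<in> N \<longleftrightarrow> y \<in> N"
proof
  assume "x \<in> N"
  then have "(x \<oplus>\<^bsub>M\<^esub> y) \<ominus>\<^bsub>M\<^esub> x \<in> N" using assms sub_minus by blast
  moreover have "(x \<oplus>\<^bsub>M\<^esub> y) \<ominus>\<^bsub>M\<^esub> x = y"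
    using assms by (simp add: a_minus_def M.a_comm M.r_neg1)
  ultimately show "y \<in> N" by simp
next
  assume "y \<in> N"
  then have "(x \<oplus>\<^bsub>M\<^esub> y) \<ominus>\<^bsub>M\<^esub> y \<in> N" using assms sub_minus by blast
  moreover have "(x \<oplus>\<^bsub>M\<^esub> y) \<ominus>\<^bsub>M\<^esub> y = x"
    using assms by (simp add: a_minus_def M.a_assoc M.r_neg)
  ultimately show "x \<in> N" by simp
qed

lemma sub_Int: "sub X \<Longrightarrow> sub Y \<Longrightarrow> sub (X \<inter> Y)"
  by (rule submoduleI) (auto simp: submoduleE sub_zero dest: sub_in_carrier)

lemma sub_Inter: "(\<And>X. X \<in> C \<Longrightarrow> sub X) \<Longrightarrow> C \<noteq> {} \<Longrightarrow> sub (\<Inter>C)"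
  by (rule submoduleI) (auto simp: submoduleE sub_zero dest: sub_in_carrier)

lemma sub_trivial: "sub {\<zero>\<^bsub>M\<^esub>}"
  by (rule submoduleI) auto

section \<open>Sums of submodules and the modular law\<close>

lemma set_add_iff: "x \<in> X <+>\<^bsub>M\<^esub> Y \<longleftrightarrow> (\<exists>u\<in>X. \<exists>v\<in>Y. x = u \<oplus>\<^bsub>M\<^esub> v)"
  by (auto simp: set_add_def')

lemma sub_add:
  assumes X: "sub X" and Y: "sub Y"
  shows "sub (X <+>\<^bsub>M\<^esub> Y)"
proof (rule submoduleI)
  note c = sub_in_carrier[OF X] sub_in_carrier[OF Y]
  show "X <+>\<^bsub>M\<^esub> Y \<subseteq> carrier M"
    by (auto simp: set_add_iff c)
  show "\<zero>\<^bsub>M\<^esub> \<in> X <+>\<^bsub>M\<^esub> Y"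
    using sub_zero[OF X] sub_zero[OF Y] by (force simp: set_add_iff)
  show "\<ominus>\<^bsub>M\<^esub> x \<in> X <+>\<^bsub>M\<^esub> Y" if "x \<in> X <+>\<^bsub>M\<^esub> Y" for x
    using that submoduleE(3)[OF X] submoduleE(3)[OF Y] M.minus_add c
    unfolding set_add_iff by metis
  show "x \<oplus>\<^bsub>M\<^esub> y \<in> X <+>\<^bsub>M\<^esub> Y" if xy: "x \<in> X <+>\<^bsub>M\<^esub> Y" "y \<in> X <+>\<^bsub>M\<^esub> Y" for x y
  proof -
    obtain u v u' v' where *: "u \<in> X" "v \<in> Y" "x = u \<oplus>\<^bsub>M\<^esub> v" "u' \<in> X" "v' \<in> Y" "y = u' \<oplus>\<^bsub>M\<^esub> v'"
      using xy unfolding set_add_iff by blast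
    have "x \<oplus>\<^bsub>M\<^esub> y = (u \<oplus>\<^bsub>M\<^esub> u') \<oplus>\<^bsub>M\<^esub> (v \<oplus>\<^bsub>M\<^esub> v')"
      using * c by (simp add: M.a_ac)
    then show ?thesis
      using * submoduleE(5)[OF X] submoduleE(5)[OF Y] unfolding set_add_iff by blast
  qed
  show "s \<odot>\<^bsub>M\<^esub> x \<in> X <+>\<^bsub>M\<^esub> Y" if "s \<in> carrier R" "x \<in> X <+>\<^bsub>M\<^esub> Y" for s x
    using that smult_r_distr c submoduleE(4)[OF X] submoduleE(4)[OF Y] unfolding set_add_iff
    by metis
qed

lemma add_ge1:
  assumes "sub X" "sub Y"
  shows "X \<subseteq> X <+>\<^bsub>M\<^esub> Y"
proof
  fix x assume "x \<in> X"
  then show "x \<in> X <+>\<^bsub>M\<^esub> Y"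
    using assms sub_zero[of Y] sub_in_carrier[of X x] M.r_zero unfolding set_add_iff by metis
qed

lemma add_ge2:
  assumes "sub X" "sub Y"
  shows "Y \<subseteq> X <+>\<^bsub>M\<^esub> Y"
proof
  fix x assume "x \<in> Y"
  then show "x \<in> X <+>\<^bsub>M\<^esub> Y"
    using assms sub_zero[of X] sub_in_carrier[of Y x] M.l_zero unfolding set_add_iff by metis
qed

lemma add_least: "sub Z \<Longrightarrow> X \<subseteq> Z \<Longrightarrow> Y \<subseteq> Z \<Longrightarrow> X <+>\<^bsub>M\<^esub> Y \<subseteq> Z"
  unfolding set_add_def' using submoduleE(5) by blast

lemma add_mono: "X \<subseteq> X' \<Longrightarrow> Y \<subseteq> Y' \<Longrightarrow> X <+>\<^bsub>M\<^esub> Y \<subseteq> X' <+>\<^bsub>M\<^esub> Y'"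
  unfolding set_add_def' by blast

lemma add_absorb1: "sub X \<Longrightarrow> sub Y \<Longrightarrow> X \<subseteq> Y \<Longrightarrow> X <+>\<^bsub>M\<^esub> Y = Y"
  using add_least add_ge2 by (metis order.refl subset_antisym)

lemma add_absorb2: "sub X \<Longrightarrow> sub Y \<Longrightarrow> Y \<subseteq> X \<Longrightarrow> X <+>\<^bsub>M\<^esub> Y = X"
  using add_least add_ge1 by (metis order.refl subset_antisym)

lemma modular_law:
  assumes "sub X" "sub Y" "sub Z" "X \<subseteq> Z"
  shows "(X <+>\<^bsub>M\<^esub> Y) \<inter> Z = X <+>\<^bsub>M\<^esub> (Y \<inter> Z)"
proof
  show "(X <+>\<^bsub>M\<^esub> Y) \<inter> Z \<subseteq> X <+>\<^bsub>M\<^esub> (Y \<inter> Z)"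
  proof
    fix x assume x: "x \<in> (X <+>\<^bsub>M\<^esub> Y) \<inter> Z"
    then obtain u v where uv: "u \<in> X" "v \<in> Y" "x = u \<oplus>\<^bsub>M\<^esub> v"
      by (auto simp: set_add_iff)
    then have "v \<in> Z"
      using x assms sub_add_cancel[of Z u v] sub_in_carrier by blast
    then show "x \<in> X <+>\<^bsub>M\<^esub> (Y \<inter> Z)" using uv by (auto simp: set_add_iff)
  qed
  show "X <+>\<^bsub>M\<^esub> (Y \<inter> Z) \<subseteq> (X <+>\<^bsub>M\<^esub> Y) \<inter> Z"
    using assms add_least[of Z X "Y \<inter> Z"] add_mono[of X X "Y \<inter> Z" Y] by blast
qed

text \<open>The modular law recovers \<open>Y\<close> from its sum and its intersection with
  \<open>K\<close>. Hence a strict step of a chain stays strict after intersecting with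
  \<open>K\<close> or after adding \<open>K\<close>.\<close>

lemma add_eq_of_modular:
  assumes "sub X" "sub Y" "sub K" "X \<subseteq> Y" "X \<inter> K = Y \<inter> K" "X <+>\<^bsub>M\<^esub> K = Y <+>\<^bsub>M\<^esub> K"
  shows "X = Y"
proof -
  have "Y = (X <+>\<^bsub>M\<^esub> K) \<inter> Y" using assms add_ge1[of Y K] by auto
  also have "\<dots> = X <+>\<^bsub>M\<^esub> (K \<inter> Y)" using assms modular_law by blast
  also have "\<dots> = X <+>\<^bsub>M\<^esub> (X \<inter> K)" using assms by (simp add: Int_commute)
  also have "\<dots> = X" using assms by (intro add_absorb2 sub_Int) auto
  finally show ?thesis by simp
qed

section \<open>Colon submodules and images under multiplication\<close>

lemma sub_colon:
  assumes "sub N" "c \<in> carrier R"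
  shows "sub (colon M N c)"
proof (rule submoduleI)
  show "s \<odot>\<^bsub>M\<^esub> x \<in> colon M N c" if "s \<in> carrier R" "x \<in> colon M N c" for s x
  proof -
    have "c \<odot>\<^bsub>M\<^esub> (s \<odot>\<^bsub>M\<^esub> x) = s \<odot>\<^bsub>M\<^esub> (c \<odot>\<^bsub>M\<^esub> x)"
      using that assms by (simp add: colon_def smult_assoc1[symmetric] R.m_comm)
    then show ?thesis using that assms by (simp add: colon_def submoduleE(4))
  qed
qed (use assms in \<open>auto simp: colon_def sub_zero smult_r_minus smult_r_distr submoduleE\<close>)

definition mult_image :: "'a \<Rightarrow> 'c set \<Rightarrow> 'c set"
  where "mult_image c X = (\<lambda>x. c \<odot>\<^bsub>M\<^esub> x) ` X"

lemma sub_mult_image: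
  assumes X: "sub X" and c: "c \<in> carrier R"
  shows "sub (mult_image c X)"
proof (rule submoduleI)
  note XC = sub_in_carrier[OF X]
  show "mult_image c X \<subseteq> carrier M" using c XC by (auto simp: mult_image_def)
  show "\<zero>\<^bsub>M\<^esub> \<in> mult_image c X"
    using sub_zero[OF X] smult_r_null[OF c] unfolding mult_image_def by force
  show "\<ominus>\<^bsub>M\<^esub> x \<in> mult_image c X" if x: "x \<in> mult_image c X" for x
  proof -
    obtain y where y: "y \<in> X" "x = c \<odot>\<^bsub>M\<^esub> y" using x by (auto simp: mult_image_def)
    then have "\<ominus>\<^bsub>M\<^esub> x = c \<odot>\<^bsub>M\<^esub> (\<ominus>\<^bsub>M\<^esub> y)" by (simp add: smult_r_minus c XC)
    then show ?thesis using y submoduleE(3)[OF X] by (simp add: mult_image_def)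
  qed
  show "x \<oplus>\<^bsub>M\<^esub> y \<in> mult_image c X" if xy: "x \<in> mult_image c X" "y \<in> mult_image c X" for x y
  proof -
    obtain u v where uv: "u \<in> X" "v \<in> X" "x = c \<odot>\<^bsub>M\<^esub> u" "y = c \<odot>\<^bsub>M\<^esub> v"
      using xy by (auto simp: mult_image_def)
    then have "x \<oplus>\<^bsub>M\<^esub> y = c \<odot>\<^bsub>M\<^esub> (u \<oplus>\<^bsub>M\<^esub> v)" by (simp add: smult_r_distr c XC)
    then show ?thesis using uv submoduleE(5)[OF X] by (simp add: mult_image_def)
  qed
  show "s \<odot>\<^bsub>M\<^esub> x \<in> mult_image c X" if sx: "s \<in> carrier R" "x \<in> mult_image c X" for s x
  proof -
    obtain y where y: "y \<in> X" "x = c \<odot>\<^bsub>M\<^esub> y" using sx by (auto simp: mult_image_def)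
    then have "s \<odot>\<^bsub>M\<^esub> x = c \<odot>\<^bsub>M\<^esub> (s \<odot>\<^bsub>M\<^esub> y)"
      using sx c XC by (simp add: smult_assoc1[symmetric] R.m_comm)
    then show ?thesis using y sx X by (auto simp: mult_image_def submoduleE(4))
  qed
qed

section \<open>Lengths of intervals of submodules\<close>

definition between :: "'c set \<Rightarrow> 'c set \<Rightarrow> 'c set set"
  where "between L N = {X. sub X \<and> L \<subseteq> X \<and> X \<subseteq> N}"

text \<open>This is l(N/L), read off from the interval of submodules by the correspondence theorem,
  so that length arguments never form a quotient. \<open>quot_module_length\<close> and
  \<open>subquot_length_len\<close> translate back.\<close>

definition len :: "'c set \<Rightarrow> 'c set \<Rightarrow> enat"
  where "len L N = chain_length (between L N)"

text \<open>A chain from \<open>L\<close> to \<open>N\<close> is projected to both sides of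
  \<open>K\<close> by intersecting with \<open>K\<close> and by adding \<open>K\<close>; each strict
  step survives in at least one projection. Conversely, chains on the two sides are
  concatenated.\<close>

lemma len_add:
  assumes L: "sub L" and K: "sub K" and N: "sub N" and LK: "L \<subseteq> K" and KN: "K \<subseteq> N"
  shows "len L N = len L K + len K N"
proof (rule antisym)
  have ne: "between L N \<noteq> {}" "between L K \<noteq> {}" "between K N \<noteq> {}"
  proof -
    have "L \<in> between L N" "L \<in> between L K" "K \<in> between K N"
      using assms by (simp_all add: between_def)
    then show "between L N \<noteq> {}" "between L K \<noteq> {}" "between K N \<noteq> {}" by blast+
  qed
  show "len L N \<le> len L K + len K N"
  proof (rule enat_leI)
    fix n assume "enat n \<le> len L N"
    then obtain S where S: "\<forall>i\<le>n. S i \<in> between L N" "\<forall>i<n. S i \<subset> S (Suc i)"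
      using enat_le_chain_length_iff[OF ne(1)] unfolding len_def has_chain_def by blast
    have sS: "sub (S i)" "L \<subseteq> S i" "S i \<subseteq> N" if "i \<le> n" for i
      using S that by (auto simp: between_def)
    let ?A = "{i. i < n \<and> S i \<inter> K \<noteq> S (Suc i) \<inter> K}"
    let ?B = "{i. i < n \<and> S i <+>\<^bsub>M\<^esub> K \<noteq> S (Suc i) <+>\<^bsub>M\<^esub> K}"
    have "has_chain (between L K) (card ?A)"
      using S(2) sS LK K
      by (intro has_chain_strict_steps[of n "\<lambda>i. S i \<inter> K"])
        (auto simp: between_def intro!: sub_Int dest: sS)
    then have A: "enat (card ?A) \<le> len L K"
      unfolding len_def by (rule has_chain_le_length)
    have "has_chain (between K N) (card ?B)"
    proof (rule has_chain_strict_steps[of n "\<lambda>i. S i <+>\<^bsub>M\<^esub> K"]; intro allI impI)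
      fix i assume "i \<le> n"
      then show "S i <+>\<^bsub>M\<^esub> K \<in> between K N"
        using sS KN K N by (simp add: between_def sub_add add_ge2 add_least)
    next
      fix i assume "i < n"
      then show "S i <+>\<^bsub>M\<^esub> K \<subseteq> S (Suc i) <+>\<^bsub>M\<^esub> K"
        using S(2) by (intro add_mono) auto
    qed
    then have B: "enat (card ?B) \<le> len K N"
      unfolding len_def by (rule has_chain_le_length)
    have "{..<n} \<subseteq> ?A \<union> ?B"
    proof
      fix i assume "i \<in> {..<n}"
      then have i: "i < n" by simp
      then have "sub (S i)" "sub (S (Suc i))" "S i \<subseteq> S (Suc i)" "S i \<noteq> S (Suc i)"
        using sS(1)[of i] sS(1)[of "Suc i"] S(2) by auto
      then have "S i \<inter> K \<noteq> S (Suc i) \<inter> K \<or> S i <+>\<^bsub>M\<^esub> K \<noteq> S (Suc i) <+>\<^bsub>M\<^esub> K"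
        using add_eq_of_modular K by blast
      then show "i \<in> ?A \<union> ?B" using i by simp
    qed
    then have "card {..<n} \<le> card (?A \<union> ?B)" by (intro card_mono) auto
    also have "\<dots> \<le> card ?A + card ?B" by (rule card_Un_le)
    finally have "enat n \<le> enat (card ?A) + enat (card ?B)" by simp
    also have "\<dots> \<le> len L K + len K N" using A B by (rule Groups.add_mono)
    finally show "enat n \<le> len L K + len K N" .
  qed
  show "len L K + len K N \<le> len L N"
  proof (rule enat_add_leI)
    fix k l assume "enat k \<le> len L K" "enat l \<le> len K N"
    then obtain S T where S: "\<forall>i\<le>k. S i \<in> between L K" "\<forall>i<k. S i \<subset> S (Suc i)"
      and T: "\<forall>i\<le>l. T i \<in> between K N" "\<forall>i<l. T i \<subset> T (Suc i)"
      using enat_le_chain_length_iff[OF ne(2), of k] enat_le_chain_length_iff[OF ne(3), of l]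
      unfolding len_def has_chain_def by blast
    \<comment> \<open>Concatenation of \<open>S\<close> and \<open>T\<close>. Of its
      \<open>k + l + 1\<close> steps the one at \<open>k\<close> may be an equality, since
      \<open>S k\<close> and \<open>T 0\<close> may both be \<open>K\<close>; the other
      \<open>k + l\<close> are strict.\<close>
    define U where "U i = (if i \<le> k then S i else T (i - Suc k))" for i
    have 1: "\<forall>i\<le>k + l + 1. U i \<in> between L N"
    proof (intro allI impI)
      fix i assume "i \<le> k + l + 1"
      then have "i \<le> k \<or> i - Suc k \<le> l" by linarith
      then show "U i \<in> between L N"
        using S(1) T(1) LK KN \<open>i \<le> k + l + 1\<close>
        by (cases "i \<le> k") (force simp: U_def between_def)+
    qed
    have step: "U i \<subset> U (Suc i)" if "i < k + l + 1" "i \<noteq> k" for i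
    proof (cases "i < k")
      case True
      then show ?thesis using S(2) by (simp add: U_def)
    next
      case False
      then have "i - Suc k < l" "Suc (i - Suc k) = i - k" using that by linarith+
      then show ?thesis using T(2)[rule_format, of "i - Suc k"] False that by (simp add: U_def)
    qed
    have "U k \<subseteq> U (Suc k)"
      using S(1)[rule_format, of k] T(1)[rule_format, of 0] by (auto simp: U_def between_def)
    then have 2: "\<forall>i<k + l + 1. U i \<subseteq> U (Suc i)" using step by (metis psubset_imp_subset)
    have "{..<k + l + 1} - {k} \<subseteq> {i. i < k + l + 1 \<and> U i \<noteq> U (Suc i)}" using step by blast
    then have "card ({..<k + l + 1} - {k}) \<le> card {i. i < k + l + 1 \<and> U i \<noteq> U (Suc i)}"
      by (intro card_mono) auto
    then have "k + l \<le> card {i. i < k + l + 1 \<and> U i \<noteq> U (Suc i)}" by simp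
    then have "has_chain (between L N) (k + l)"
      using has_chain_antimono has_chain_strict_steps[OF 1 2] by blast
    then show "enat (k + l) \<le> len L N" unfolding len_def by (rule has_chain_le_length)
  qed
qed

lemma len_eq_0_iff:
  assumes "sub L" "sub N" "L \<subseteq> N"
  shows "len L N = 0 \<longleftrightarrow> L = N"
proof
  assume 0: "len L N = 0"
  show "L = N"
  proof (rule ccontr)
    assume "L \<noteq> N"
    then have "has_chain (between L N) 1"
      using assms unfolding has_chain_def
      by (intro exI[of _ "\<lambda>i. if i = 0 then L else N"]) (auto simp: between_def)
    then show False using has_chain_le_length 0 unfolding len_def
      by (metis enat_ord_simps(1) not_one_le_zero zero_enat_def)
  qed
next
  assume "L = N"
  have "k = 0" if "has_chain (between L N) k" for k
  proof (rule ccontr)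
    assume "k \<noteq> 0"
    then have "has_chain (between L N) 1" using has_chain_antimono[OF that, of 1] by simp
    then obtain T where "\<forall>i\<le>1. T i \<in> between L N" "\<forall>i<1. T i \<subset> T (Suc i)"
      unfolding has_chain_def by blast
    then have "T 0 \<in> between L N" "T 1 \<in> between L N" "T 0 \<subset> T 1" by simp_all
    then show False using \<open>L = N\<close> unfolding between_def by blast
  qed
  then have "len L N \<le> 0"
    unfolding len_def chain_length_def by (intro Sup_least) (auto simp: zero_enat_def)
  then show "len L N = 0" by simp
qed

text \<open>Second isomorphism theorem. By the modular law, intersecting with \<open>A\<close> and
  adding \<open>B\<close> are mutually inverse on the two intervals.\<close>

lemma len_diamond:
  assumes A: "sub A" and B: "sub B"
  shows "len B (A <+>\<^bsub>M\<^esub> B) = len (A \<inter> B) A"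
  unfolding len_def
proof (rule antisym)
  show "chain_length (between B (A <+>\<^bsub>M\<^esub> B)) \<le> chain_length (between (A \<inter> B) A)"
  proof (rule chain_length_mono_map[of _ "\<lambda>X. X \<inter> A"])
    fix X Y assume XY: "X \<in> between B (A <+>\<^bsub>M\<^esub> B)" "Y \<in> between B (A <+>\<^bsub>M\<^esub> B)" "X \<subset> Y"
    have *: "B <+>\<^bsub>M\<^esub> (A \<inter> Z) = Z" if "Z \<in> between B (A <+>\<^bsub>M\<^esub> B)" for Z
    proof -
      have "(B <+>\<^bsub>M\<^esub> A) \<inter> Z = Z"
        using that A B add_ge1[OF B A] add_ge2[OF B A] add_least[of "B <+>\<^bsub>M\<^esub> A" A B] sub_add
        by (auto simp: between_def)
      then show ?thesis using modular_law[OF B A, of Z] that by (auto simp: between_def)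
    qed
    have "X \<inter> A \<noteq> Y \<inter> A" using *[of X] *[of Y] XY by (metis Int_commute psubset_eq)
    then show "X \<inter> A \<subset> Y \<inter> A" using XY by auto
  qed (use A B in \<open>auto simp: between_def sub_Int\<close>)
  show "chain_length (between (A \<inter> B) A) \<le> chain_length (between B (A <+>\<^bsub>M\<^esub> B))"
  proof (rule chain_length_mono_map[of _ "\<lambda>X. X <+>\<^bsub>M\<^esub> B"])
    fix X Y assume XY: "X \<in> between (A \<inter> B) A" "Y \<in> between (A \<inter> B) A" "X \<subset> Y"
    have *: "(Z <+>\<^bsub>M\<^esub> B) \<inter> A = Z" if "Z \<in> between (A \<inter> B) A" for Z
      using that modular_law[of Z B A] add_absorb2[of Z "B \<inter> A"] A B sub_Int
      by (auto simp: between_def Int_commute)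
    have "X <+>\<^bsub>M\<^esub> B \<noteq> Y <+>\<^bsub>M\<^esub> B" using *[of X] *[of Y] XY by auto
    then show "X <+>\<^bsub>M\<^esub> B \<subset> Y <+>\<^bsub>M\<^esub> B" using XY add_mono[of X Y B B] by auto
  next
    fix X assume "X \<in> between (A \<inter> B) A"
    then show "X <+>\<^bsub>M\<^esub> B \<in> between B (A <+>\<^bsub>M\<^esub> B)"
      using A B by (simp add: between_def sub_add add_ge2 add_mono)
  qed
qed

text \<open>Multiplication by \<open>c\<close> induces an isomorphism from M/(Q : c) onto (cM +
  Q)/Q. On intervals it is X |-> cX + Q, with X |-> X : c in the other direction.\<close>

lemma len_colon:
  assumes Q: "sub Q" and c: "c \<in> carrier R"
  shows "len (colon M Q c) (carrier M) = len Q (mult_image c (carrier M) <+>\<^bsub>M\<^esub> Q)"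
  unfolding len_def
proof (rule antisym)
  let ?C = "mult_image c (carrier M) <+>\<^bsub>M\<^esub> Q"
  have sc: "sub (mult_image c X)" if "sub X" for X by (rule sub_mult_image[OF that c])
  show "chain_length (between (colon M Q c) (carrier M)) \<le> chain_length (between Q ?C)"
  proof (rule chain_length_mono_map[of _ "\<lambda>X. mult_image c X <+>\<^bsub>M\<^esub> Q"])
    fix X assume "X \<in> between (colon M Q c) (carrier M)"
    then have X: "sub X" "X \<subseteq> carrier M" by (auto simp: between_def)
    then have "mult_image c X \<subseteq> mult_image c (carrier M)" by (auto simp: mult_image_def)
    then show "mult_image c X <+>\<^bsub>M\<^esub> Q \<in> between Q ?C"
      using X Q sc by (simp add: between_def sub_add add_ge2 add_mono)
  next
    fix X Y assume XY: "X \<in> between (colon M Q c) (carrier M)" "Y \<in> between (colon M Q c) (carrier M)"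
      "X \<subset> Y"
    then have s: "sub X" "sub Y" "colon M Q c \<subseteq> X" by (auto simp: between_def)
    have "mult_image c X \<subseteq> mult_image c Y" using XY by (auto simp: mult_image_def)
    then have le: "mult_image c X <+>\<^bsub>M\<^esub> Q \<subseteq> mult_image c Y <+>\<^bsub>M\<^esub> Q" by (rule add_mono) simp
    have "mult_image c X <+>\<^bsub>M\<^esub> Q \<noteq> mult_image c Y <+>\<^bsub>M\<^esub> Q"
    proof
      assume eq: "mult_image c X <+>\<^bsub>M\<^esub> Q = mult_image c Y <+>\<^bsub>M\<^esub> Q"
      obtain y where y: "y \<in> Y" "y \<notin> X" using XY by auto
      have "c \<odot>\<^bsub>M\<^esub> y \<in> mult_image c X <+>\<^bsub>M\<^esub> Q"
        unfolding eq using add_ge1[OF sc[OF s(2)] Q] y by (auto simp: mult_image_def)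
      then obtain x z where xz: "x \<in> X" "z \<in> Q" "c \<odot>\<^bsub>M\<^esub> y = c \<odot>\<^bsub>M\<^esub> x \<oplus>\<^bsub>M\<^esub> z"
        by (auto simp: mult_image_def set_add_iff)
      have car: "x \<in> carrier M" "y \<in> carrier M" "z \<in> carrier M"
        using xz y s Q sub_in_carrier by blast+
      \<comment> \<open>Equality of the images puts the difference of \<open>y\<close> and
        \<open>x\<close> into Q : c, which every member of the interval contains.\<close>
      have "c \<odot>\<^bsub>M\<^esub> (y \<ominus>\<^bsub>M\<^esub> x) = z"
        using xz(3) car c
        by (simp add: a_minus_def smult_r_distr smult_r_minus M.a_comm M.a_assoc M.r_neg
            M.a_lcomm[of _ z])
      then have "y \<ominus>\<^bsub>M\<^esub> x \<in> X" using xz car s(3) by (auto simp: colon_def)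
      then have "(y \<ominus>\<^bsub>M\<^esub> x) \<oplus>\<^bsub>M\<^esub> x \<in> X" using xz s by (simp add: submoduleE)
      moreover have "(y \<ominus>\<^bsub>M\<^esub> x) \<oplus>\<^bsub>M\<^esub> x = y"
        using car by (simp add: a_minus_def M.a_assoc M.l_neg)
      ultimately show False using y by simp
    qed
    then show "mult_image c X <+>\<^bsub>M\<^esub> Q \<subset> mult_image c Y <+>\<^bsub>M\<^esub> Q" using le by auto
  qed
  show "chain_length (between Q ?C) \<le> chain_length (between (colon M Q c) (carrier M))"
  proof (rule chain_length_mono_map[of _ "\<lambda>X. colon M X c"])
    fix X assume "X \<in> between Q ?C"
    then show "colon M X c \<in> between (colon M Q c) (carrier M)"
      using c by (auto simp: between_def sub_colon) (auto simp: colon_def)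
  next
    fix X Y assume XY: "X \<in> between Q ?C" "Y \<in> between Q ?C" "X \<subset> Y"
    then have s: "sub X" "sub Y" "Q \<subseteq> X" "Q \<subseteq> Y" "Y \<subseteq> ?C" by (auto simp: between_def)
    have "colon M X c \<noteq> colon M Y c"
    proof
      assume eq: "colon M X c = colon M Y c"
      obtain y where y: "y \<in> Y" "y \<notin> X" using XY by auto
      then have "y \<in> ?C" using s by blast
      then obtain x z where xz: "x \<in> carrier M" "z \<in> Q" "y = c \<odot>\<^bsub>M\<^esub> x \<oplus>\<^bsub>M\<^esub> z"
        by (auto simp: mult_image_def set_add_iff)
      then have "c \<odot>\<^bsub>M\<^esub> x \<in> Y"
        using sub_add_cancel[OF s(2), of "c \<odot>\<^bsub>M\<^esub> x" z] y s c sub_in_carrier[OF Q] by auto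
      then have "x \<in> colon M X c" unfolding eq using xz by (simp add: colon_def)
      then show False using y xz s by (auto simp: colon_def submoduleE)
    qed
    then show "colon M X c \<subset> colon M Y c" using XY by (auto simp: colon_def)
  qed
qed

end

section \<open>Quotient modules\<close>

context module
begin

section \<open>Cosets and the operations of the quotient\<close>

lemma sub_subgroup: "sub N \<Longrightarrow> subgroup N (add_monoid M)"
  by (simp add: submodule_def)

lemma sub_abelian_subgroup: "sub N \<Longrightarrow> abelian_subgroup N M"
  by (intro abelian_subgroupI3 additive_subgroupI sub_subgroup M.abelian_group_axioms)

lemma coset_mem:
  assumes "sub N" "x \<in> carrier M"
  shows "y \<in> N +>\<^bsub>M\<^esub> x \<longleftrightarrow> (\<exists>h\<in>N. y = h \<oplus>\<^bsub>M\<^esub> x)"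
  by (auto simp: a_r_coset_def')

lemma coset_eq_iff:
  assumes N: "sub N" and x: "x \<in> carrier M" and y: "y \<in> carrier M"
  shows "N +>\<^bsub>M\<^esub> x = N +>\<^bsub>M\<^esub> y \<longleftrightarrow> x \<ominus>\<^bsub>M\<^esub> y \<in> N"
proof
  assume "N +>\<^bsub>M\<^esub> x = N +>\<^bsub>M\<^esub> y"
  then have "x \<in> N +>\<^bsub>M\<^esub> y"
    using abelian_subgroup.a_rcos_self[OF sub_abelian_subgroup[OF N] x] by simp
  then obtain h where "h \<in> N" "x = h \<oplus>\<^bsub>M\<^esub> y" using coset_mem N y by blast
  then show "x \<ominus>\<^bsub>M\<^esub> y \<in> N"
    using y sub_in_carrier[OF N] by (simp add: a_minus_def M.a_assoc M.r_neg)
next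
  assume h: "x \<ominus>\<^bsub>M\<^esub> y \<in> N"
  have "x = (x \<ominus>\<^bsub>M\<^esub> y) \<oplus>\<^bsub>M\<^esub> y" using x y by (simp add: a_minus_def M.a_assoc M.l_neg)
  then have "x \<in> N +>\<^bsub>M\<^esub> y" using h coset_mem N y by blast
  then show "N +>\<^bsub>M\<^esub> x = N +>\<^bsub>M\<^esub> y"
    using M.a_repr_independence[OF _ y sub_subgroup[OF N]] by simp
qed

lemma smult_minus_distr:
  "c \<in> carrier R \<Longrightarrow> x \<in> carrier M \<Longrightarrow> y \<in> carrier M \<Longrightarrow>
    c \<odot>\<^bsub>M\<^esub> (x \<ominus>\<^bsub>M\<^esub> y) = c \<odot>\<^bsub>M\<^esub> x \<ominus>\<^bsub>M\<^esub> c \<odot>\<^bsub>M\<^esub> y"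
  by (simp add: a_minus_def smult_r_distr smult_r_minus)

text \<open>The scalar product is defined as a union over representatives. All representatives of a
  coset contribute the same coset, so the union collapses to it.\<close>

lemma quot_smult:
  assumes N: "sub N" and c: "c \<in> carrier R" and x: "x \<in> carrier M"
  shows "c \<odot>\<^bsub>quot_module M N\<^esub> (N +>\<^bsub>M\<^esub> x) = N +>\<^bsub>M\<^esub> (c \<odot>\<^bsub>M\<^esub> x)"
proof -
  have const: "N +>\<^bsub>M\<^esub> (c \<odot>\<^bsub>M\<^esub> y) = N +>\<^bsub>M\<^esub> (c \<odot>\<^bsub>M\<^esub> x)" if y: "y \<in> N +>\<^bsub>M\<^esub> x" for y
  proof -
    have yc: "y \<in> carrier M"
      using y N x by (auto simp: coset_mem dest: sub_in_carrier)
    have "N +>\<^bsub>M\<^esub> y = N +>\<^bsub>M\<^esub> x"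
      using M.a_repr_independence[OF y x sub_subgroup[OF N]] by simp
    then have "c \<odot>\<^bsub>M\<^esub> (y \<ominus>\<^bsub>M\<^esub> x) \<in> N"
      using coset_eq_iff[OF N yc x] submoduleE(4)[OF N c] by simp
    then show ?thesis
      using coset_eq_iff[OF N, of "c \<odot>\<^bsub>M\<^esub> y" "c \<odot>\<^bsub>M\<^esub> x"] yc x c by (simp add: smult_minus_distr)
  qed
  have "N +>\<^bsub>M\<^esub> x \<noteq> {}"
    using abelian_subgroup.a_rcos_self[OF sub_abelian_subgroup[OF N] x] by blast
  then have "(\<Union>y\<in>N +>\<^bsub>M\<^esub> x. N +>\<^bsub>M\<^esub> (c \<odot>\<^bsub>M\<^esub> y)) = N +>\<^bsub>M\<^esub> (c \<odot>\<^bsub>M\<^esub> x)"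
    using const by (rule SUP_eq_const)
  then show ?thesis by (simp add: quot_module_def)
qed

lemma quot_carrier: "carrier (quot_module M N) = (\<lambda>x. N +>\<^bsub>M\<^esub> x) ` carrier M"
  by (auto simp: quot_module_def A_RCOSETS_def')

lemma quot_add:
  assumes "sub N" "x \<in> carrier M" "y \<in> carrier M"
  shows "(N +>\<^bsub>M\<^esub> x) \<oplus>\<^bsub>quot_module M N\<^esub> (N +>\<^bsub>M\<^esub> y) = N +>\<^bsub>M\<^esub> (x \<oplus>\<^bsub>M\<^esub> y)"
  using abelian_subgroup.a_rcos_sum[OF sub_abelian_subgroup[OF assms(1)] assms(2,3)]
  by (simp add: quot_module_def)

lemma quot_zero: "sub N \<Longrightarrow> \<zero>\<^bsub>quot_module M N\<^esub> = N +>\<^bsub>M\<^esub> \<zero>\<^bsub>M\<^esub>"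
  by (simp add: quot_module_def submoduleE(1))

lemma coset_of_mem: "sub N \<Longrightarrow> x \<in> N \<Longrightarrow> N +>\<^bsub>M\<^esub> x = \<zero>\<^bsub>quot_module M N\<^esub>"
  using M.a_coset_join2[OF _ sub_subgroup] sub_in_carrier by (simp add: quot_module_def)

lemma quot_module_is_module:
  assumes N: "sub N"
  shows "module R (quot_module M N)"
proof (rule moduleI)
  show "cring R" by (rule R.is_cring)
  show "abelian_group (quot_module M N)"
  proof (rule abelian_groupI)
    show "\<exists>D\<in>carrier (quot_module M N). D \<oplus>\<^bsub>quot_module M N\<^esub> C = \<zero>\<^bsub>quot_module M N\<^esub>"
      if C: "C \<in> carrier (quot_module M N)" for C
    proof -
      obtain x where x: "x \<in> carrier M" "C = N +>\<^bsub>M\<^esub> x" using C by (auto simp: quot_carrier)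
      then have "(N +>\<^bsub>M\<^esub> (\<ominus>\<^bsub>M\<^esub> x)) \<oplus>\<^bsub>quot_module M N\<^esub> C = \<zero>\<^bsub>quot_module M N\<^esub>"
        using N by (simp add: quot_add quot_zero M.l_neg)
      then show ?thesis using x by (auto simp: quot_carrier)
    qed
  qed (use N in \<open>auto simp: quot_carrier quot_add quot_zero M.a_ac\<close>)
qed (use N in \<open>auto simp: quot_carrier quot_smult quot_add smult_l_distr smult_r_distr smult_assoc1\<close>)

section \<open>The correspondence theorem\<close>

lemma sub_image_coset:
  assumes N: "sub N" and X: "sub X"
  shows "submodule ((\<lambda>x. N +>\<^bsub>M\<^esub> x) ` X) R (quot_module M N)"
proof (rule module.submoduleI[OF quot_module_is_module[OF N]])
  interpret L: module R "quot_module M N" by (rule quot_module_is_module[OF N])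
  note c = sub_in_carrier[OF X]
  show "(\<lambda>x. N +>\<^bsub>M\<^esub> x) ` X \<subseteq> carrier (quot_module M N)" using c by (auto simp: quot_carrier)
  show "\<zero>\<^bsub>quot_module M N\<^esub> \<in> (\<lambda>x. N +>\<^bsub>M\<^esub> x) ` X"
    using sub_zero[OF X] by (auto simp: quot_zero[OF N])
  show sm: "s \<odot>\<^bsub>quot_module M N\<^esub> C \<in> (\<lambda>x. N +>\<^bsub>M\<^esub> x) ` X"
    if "s \<in> carrier R" "C \<in> (\<lambda>x. N +>\<^bsub>M\<^esub> x) ` X" for s C
    using that N c submoduleE(4)[OF X] by (auto simp: quot_smult)
  show "C \<oplus>\<^bsub>quot_module M N\<^esub> D \<in> (\<lambda>x. N +>\<^bsub>M\<^esub> x) ` X"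
    if "C \<in> (\<lambda>x. N +>\<^bsub>M\<^esub> x) ` X" "D \<in> (\<lambda>x. N +>\<^bsub>M\<^esub> x) ` X" for C D
    using that N c submoduleE(5)[OF X] by (auto simp: quot_add)
  show "\<ominus>\<^bsub>quot_module M N\<^esub> C \<in> (\<lambda>x. N +>\<^bsub>M\<^esub> x) ` X" if C: "C \<in> (\<lambda>x. N +>\<^bsub>M\<^esub> x) ` X" for C
  proof -
    have "C \<in> carrier (quot_module M N)" using C c by (auto simp: quot_carrier)
    \<comment> \<open>Writing the negative as the multiple by -1 reduces closure under negation to
      closure under scalars, without computing inverses of cosets.\<close>
    then have "\<ominus>\<^bsub>quot_module M N\<^esub> C = (\<ominus>\<^bsub>R\<^esub> \<one>\<^bsub>R\<^esub>) \<odot>\<^bsub>quot_module M N\<^esub> C"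
      by (simp add: L.smult_l_minus)
    then show ?thesis using sm[OF _ C] by simp
  qed
qed

lemma sub_coset_preimage:
  assumes N: "sub N" and Y: "submodule Y R (quot_module M N)"
  shows "sub {x \<in> carrier M. N +>\<^bsub>M\<^esub> x \<in> Y}" (is "sub ?P")
proof (rule submoduleI)
  interpret L: module R "quot_module M N" by (rule quot_module_is_module[OF N])
  show "?P \<subseteq> carrier M" by auto
  show "\<zero>\<^bsub>M\<^esub> \<in> ?P"
    using L.sub_zero[OF Y] by (simp add: quot_zero[OF N])
  show sm: "s \<odot>\<^bsub>M\<^esub> x \<in> ?P" if "s \<in> carrier R" "x \<in> ?P" for s x
    using that L.submoduleE(4)[OF Y, of s "N +>\<^bsub>M\<^esub> x"] N by (simp add: quot_smult)
  show "x \<oplus>\<^bsub>M\<^esub> y \<in> ?P" if "x \<in> ?P" "y \<in> ?P" for x y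
    using that L.submoduleE(5)[OF Y, of "N +>\<^bsub>M\<^esub> x" "N +>\<^bsub>M\<^esub> y"] N by (simp add: quot_add)
  show "\<ominus>\<^bsub>M\<^esub> x \<in> ?P" if x: "x \<in> ?P" for x
  proof -
    have "\<ominus>\<^bsub>M\<^esub> x = (\<ominus>\<^bsub>R\<^esub> \<one>\<^bsub>R\<^esub>) \<odot>\<^bsub>M\<^esub> x" using x by (simp add: smult_l_minus)
    then show ?thesis using sm[OF _ x, of "\<ominus>\<^bsub>R\<^esub> \<one>\<^bsub>R\<^esub>"] by simp
  qed
qed

lemma coset_image_mem_iff:
  assumes "sub N" "sub X" "N \<subseteq> X" "x \<in> carrier M"
  shows "N +>\<^bsub>M\<^esub> x \<in> (\<lambda>x. N +>\<^bsub>M\<^esub> x) ` X \<longleftrightarrow> x \<in> X"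
proof
  assume "N +>\<^bsub>M\<^esub> x \<in> (\<lambda>x. N +>\<^bsub>M\<^esub> x) ` X"
  then obtain y where y: "y \<in> X" "N +>\<^bsub>M\<^esub> x = N +>\<^bsub>M\<^esub> y" by auto
  then have yc: "y \<in> carrier M" using assms sub_in_carrier by blast
  then have "x \<ominus>\<^bsub>M\<^esub> y \<in> X" using y assms coset_eq_iff by blast
  then have "(x \<ominus>\<^bsub>M\<^esub> y) \<oplus>\<^bsub>M\<^esub> y \<in> X" using y assms submoduleE(5) by blast
  moreover have "(x \<ominus>\<^bsub>M\<^esub> y) \<oplus>\<^bsub>M\<^esub> y = x" using assms yc by (simp add: a_minus_def M.a_assoc M.l_neg)
  ultimately show "x \<in> X" by simp
qed auto

lemma coset_preimage_image:
  assumes "sub N" "sub X" "N \<subseteq> X"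
  shows "{x \<in> carrier M. N +>\<^bsub>M\<^esub> x \<in> (\<lambda>x. N +>\<^bsub>M\<^esub> x) ` X} = X"
  using coset_image_mem_iff[OF assms] sub_in_carrier[OF assms(2)] by blast

lemma coset_image_eq_iff:
  assumes "sub N" "sub X" "N \<subseteq> X" "sub Y" "N \<subseteq> Y"
  shows "(\<lambda>x. N +>\<^bsub>M\<^esub> x) ` X = (\<lambda>x. N +>\<^bsub>M\<^esub> x) ` Y \<longleftrightarrow> X = Y"
  using coset_preimage_image assms by metis

text \<open>Taking preimages and taking images of submodules under the coset map are both strictly
  monotone, which bounds each length by the other.\<close>

lemma quot_module_length:
  assumes N: "sub N"
  shows "module_length R (quot_module M N) = len N (carrier M)"
  unfolding module_length_chain_length len_def
proof (rule antisym)
  interpret L: module R "quot_module M N" by (rule quot_module_is_module[OF N])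
  show "chain_length {Y. submodule Y R (quot_module M N)} \<le> chain_length (between N (carrier M))"
  proof (rule chain_length_mono_map[of _ "\<lambda>Y. {x \<in> carrier M. N +>\<^bsub>M\<^esub> x \<in> Y}"])
    fix Y assume "Y \<in> {Y. submodule Y R (quot_module M N)}"
    then have Y: "submodule Y R (quot_module M N)" by simp
    have "N \<subseteq> {x \<in> carrier M. N +>\<^bsub>M\<^esub> x \<in> Y}"
    proof
      fix x assume x: "x \<in> N"
      then show "x \<in> {x \<in> carrier M. N +>\<^bsub>M\<^esub> x \<in> Y}"
        using L.sub_zero[OF Y] sub_in_carrier[OF N] by (simp add: coset_of_mem[OF N])
    qed
    then show "{x \<in> carrier M. N +>\<^bsub>M\<^esub> x \<in> Y} \<in> between N (carrier M)"
      using sub_coset_preimage[OF N Y] by (auto simp: between_def)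
  next
    fix X Y assume "X \<in> {Y. submodule Y R (quot_module M N)}" "Y \<in> {Y. submodule Y R (quot_module M N)}"
      and XY: "X \<subset> Y"
    then have Y: "Y \<subseteq> carrier (quot_module M N)" using L.submoduleE(1) by blast
    obtain C where C: "C \<in> Y" "C \<notin> X" using XY by auto
    then obtain x where "x \<in> carrier M" "C = N +>\<^bsub>M\<^esub> x" using Y by (auto simp: quot_carrier)
    then show "{x \<in> carrier M. N +>\<^bsub>M\<^esub> x \<in> X} \<subset> {x \<in> carrier M. N +>\<^bsub>M\<^esub> x \<in> Y}"
      using XY C by blast
  qed
  show "chain_length (between N (carrier M)) \<le> chain_length {Y. submodule Y R (quot_module M N)}"
  proof (rule chain_length_mono_map[of _ "\<lambda>X. (\<lambda>x. N +>\<^bsub>M\<^esub> x) ` X"])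
    fix X Y assume "X \<in> between N (carrier M)" "Y \<in> between N (carrier M)" "X \<subset> Y"
    then show "(\<lambda>x. N +>\<^bsub>M\<^esub> x) ` X \<subset> (\<lambda>x. N +>\<^bsub>M\<^esub> x) ` Y"
      using coset_image_eq_iff[OF N, of X Y] by (auto simp: between_def)
  qed (auto simp: between_def sub_image_coset N)
qed

lemma sub_restrict_iff:
  assumes N: "sub N"
  shows "submodule X R (M\<lparr>carrier := N\<rparr>) \<longleftrightarrow> sub X \<and> X \<subseteq> N"
proof -
  interpret K: module R "M\<lparr>carrier := N\<rparr>" by (rule submodule.submodule_is_module[OF N module_axioms])
  \<comment> \<open>The inverse in the restricted record is taken with respect to the smaller
    carrier. It agrees with the one in \<open>M\<close> because both are the multiple by -1.\<close>
  have minus: "\<ominus>\<^bsub>M\<lparr>carrier := N\<rparr>\<^esub> x = \<ominus>\<^bsub>M\<^esub> x" if x: "x \<in> N" for x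
    using K.smult_l_minus[of "\<one>\<^bsub>R\<^esub>" x] smult_l_minus[of "\<one>\<^bsub>R\<^esub>" x] x sub_in_carrier[OF N x] K.smult_one[of x]
    by simp
  show ?thesis
  proof (intro iffI conjI)
    assume X: "submodule X R (M\<lparr>carrier := N\<rparr>)"
    show XN: "X \<subseteq> N" using K.submoduleE(1)[OF X] by simp
    show "sub X"
    proof (rule submoduleI)
      show "\<ominus>\<^bsub>M\<^esub> x \<in> X" if "x \<in> X" for x
        using K.submoduleE(3)[OF X that] minus that XN by auto
    qed (use K.submoduleE[OF X] K.sub_zero[OF X] XN sub_in_carrier[OF N] in auto)
  next
    assume *: "sub X \<and> X \<subseteq> N"
    then have X: "sub X" by simp
    show "submodule X R (M\<lparr>carrier := N\<rparr>)"
    proof (rule K.submoduleI)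
      show "\<ominus>\<^bsub>M\<lparr>carrier := N\<rparr>\<^esub> x \<in> X" if "x \<in> X" for x
        using submoduleE(3)[OF X that] minus that * by auto
    qed (use submoduleE[OF X] sub_zero[OF X] * in auto)
  qed
qed

text \<open>The interval from \<open>L\<close> to \<open>N\<close> is the same whether it is formed
  in \<open>M\<close> or in the module \<open>N\<close>.\<close>

lemma subquot_length_len:
  assumes N: "sub N" and L: "sub L" and LN: "L \<subseteq> N"
  shows "subquot_length R M N L = len L N"
proof -
  interpret K: module R "M\<lparr>carrier := N\<rparr>" by (rule submodule.submodule_is_module[OF N module_axioms])
  have "between L N = K.between L N"
    unfolding between_def K.between_def using sub_restrict_iff[OF N] by auto
  then have "len L N = K.len L N" unfolding len_def K.len_def by simp
  then show ?thesis
    unfolding subquot_length_def using K.quot_module_length[of L] sub_restrict_iff[OF N] L LN by simp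
qed

section \<open>Generated submodules and the action of ideals\<close>

lemma sub_submodule_gen:
  assumes "S \<subseteq> carrier M"
  shows "sub (submodule_gen R M S)"
  unfolding submodule_gen_def using assms carrier_is_submodule by (intro sub_Inter) auto

lemma submodule_gen_least: "sub N \<Longrightarrow> S \<subseteq> N \<Longrightarrow> submodule_gen R M S \<subseteq> N"
  unfolding submodule_gen_def by auto

lemma submodule_gen_superset: "S \<subseteq> submodule_gen R M S"
  unfolding submodule_gen_def by auto

lemma sub_ideal_smult: "I \<subseteq> carrier R \<Longrightarrow> sub (ideal_smult R M I)"
  unfolding ideal_smult_def by (intro sub_submodule_gen) auto

lemma ideal_smult_leI:
  assumes "sub N" "\<And>c x. c \<in> I \<Longrightarrow> x \<in> carrier M \<Longrightarrow> c \<odot>\<^bsub>M\<^esub> x \<in> N"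
  shows "ideal_smult R M I \<subseteq> N"
  unfolding ideal_smult_def using assms by (intro submodule_gen_least) auto

lemma smult_in_ideal_smult: "c \<in> I \<Longrightarrow> x \<in> carrier M \<Longrightarrow> c \<odot>\<^bsub>M\<^esub> x \<in> ideal_smult R M I"
  unfolding ideal_smult_def by (rule subsetD[OF submodule_gen_superset]) blast

text \<open>Each inclusion is tested on generators: the image of N + IM contains all products of
  \<open>I\<close> with cosets, and the preimage of I(M/N) contains \<open>N\<close> and all
  products of \<open>I\<close> with elements of \<open>M\<close>.\<close>

lemma quot_ideal_smult:
  assumes N: "sub N" and I: "I \<subseteq> carrier R"
  shows "ideal_smult R (quot_module M N) I = (\<lambda>x. N +>\<^bsub>M\<^esub> x) ` (N <+>\<^bsub>M\<^esub> ideal_smult R M I)"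
proof
  interpret L: module R "quot_module M N" by (rule quot_module_is_module[OF N])
  let ?L = "ideal_smult R (quot_module M N) I"
  have S: "sub (N <+>\<^bsub>M\<^esub> ideal_smult R M I)" by (intro sub_add N sub_ideal_smult I)
  show "?L \<subseteq> (\<lambda>x. N +>\<^bsub>M\<^esub> x) ` (N <+>\<^bsub>M\<^esub> ideal_smult R M I)"
  proof (rule L.ideal_smult_leI)
    show "submodule ((\<lambda>x. N +>\<^bsub>M\<^esub> x) ` (N <+>\<^bsub>M\<^esub> ideal_smult R M I)) R (quot_module M N)"
      by (rule sub_image_coset[OF N S])
    fix c C assume c: "c \<in> I" and "C \<in> carrier (quot_module M N)"
    then obtain x where x: "x \<in> carrier M" "C = N +>\<^bsub>M\<^esub> x" by (auto simp: quot_carrier)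
    then have "c \<odot>\<^bsub>M\<^esub> x \<in> N <+>\<^bsub>M\<^esub> ideal_smult R M I"
      using smult_in_ideal_smult[OF c] add_ge2[OF N sub_ideal_smult[OF I]] by blast
    then show "c \<odot>\<^bsub>quot_module M N\<^esub> C \<in> (\<lambda>x. N +>\<^bsub>M\<^esub> x) ` (N <+>\<^bsub>M\<^esub> ideal_smult R M I)"
      using x c I N by (auto simp: quot_smult subset_iff)
  qed
  have sL: "submodule ?L R (quot_module M N)" by (rule L.sub_ideal_smult[OF I])
  have P: "sub {x \<in> carrier M. N +>\<^bsub>M\<^esub> x \<in> ?L}" (is "sub ?P")
    by (rule sub_coset_preimage[OF N sL])
  have "N <+>\<^bsub>M\<^esub> ideal_smult R M I \<subseteq> ?P"
  proof (rule add_least[OF P])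
    show "N \<subseteq> ?P"
    proof
      fix x assume x: "x \<in> N"
      then show "x \<in> ?P"
        using L.sub_zero[OF sL] sub_in_carrier[OF N] by (simp add: coset_of_mem[OF N])
    qed
    show "ideal_smult R M I \<subseteq> ?P"
    proof (rule ideal_smult_leI[OF P])
      fix c x assume c: "c \<in> I" and x: "x \<in> carrier M"
      then have "c \<odot>\<^bsub>quot_module M N\<^esub> (N +>\<^bsub>M\<^esub> x) \<in> ?L"
        by (intro L.smult_in_ideal_smult) (auto simp: quot_carrier)
      then show "c \<odot>\<^bsub>M\<^esub> x \<in> ?P" using c x I N by (auto simp: quot_smult subset_iff)
    qed
  qed
  then show "(\<lambda>x. N +>\<^bsub>M\<^esub> x) ` (N <+>\<^bsub>M\<^esub> ideal_smult R M I) \<subseteq> ?L" by auto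
qed

lemma quot_colon:
  assumes N: "sub N" and X: "sub X" and NX: "N \<subseteq> X" and c: "c \<in> carrier R"
  shows "colon (quot_module M N) ((\<lambda>x. N +>\<^bsub>M\<^esub> x) ` X) c = (\<lambda>x. N +>\<^bsub>M\<^esub> x) ` colon M X c"
proof -
  have "c \<odot>\<^bsub>quot_module M N\<^esub> (N +>\<^bsub>M\<^esub> x) \<in> (\<lambda>x. N +>\<^bsub>M\<^esub> x) ` X \<longleftrightarrow> c \<odot>\<^bsub>M\<^esub> x \<in> X"
    if "x \<in> carrier M" for x
    using that c coset_image_mem_iff[OF N X NX, of "c \<odot>\<^bsub>M\<^esub> x"] N by (simp add: quot_smult)
  then show ?thesis by (auto simp: colon_def quot_carrier)
qed

lemma coset_image_Int:
  assumes N: "sub N" and X: "sub X" and Y: "sub Y" and NX: "N \<subseteq> X" and NY: "N \<subseteq> Y"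
  shows "(\<lambda>x. N +>\<^bsub>M\<^esub> x) ` X \<inter> (\<lambda>x. N +>\<^bsub>M\<^esub> x) ` Y = (\<lambda>x. N +>\<^bsub>M\<^esub> x) ` (X \<inter> Y)"
  using coset_image_mem_iff[OF N Y NY] sub_in_carrier[OF X] by auto

end

section \<open>The action of a sequence on submodules\<close>

context module
begin

text \<open>The ideal quotient N : X in the ring. It allows statements about all elements of a
  generated ideal to be tested on generators.\<close>

lemma ideal_colon:
  assumes N: "sub N" and X: "X \<subseteq> carrier M"
  shows "ideal {c \<in> carrier R. \<forall>x\<in>X. c \<odot>\<^bsub>M\<^esub> x \<in> N} R" (is "ideal ?I R")
proof (rule idealI[OF R.ring_axioms])
  have XC: "x \<in> X \<Longrightarrow> x \<in> carrier M" for x using X by auto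
  show "subgroup ?I (add_monoid R)"
  proof (rule R.add.subgroupI)
    show "?I \<noteq> {}" using XC sub_zero[OF N] by (auto intro!: exI[of _ "\<zero>\<^bsub>R\<^esub>"])
    show "\<ominus>\<^bsub>R\<^esub> c \<in> ?I" if "c \<in> ?I" for c
      using that XC submoduleE(3)[OF N] by (simp add: smult_l_minus)
    show "c \<oplus>\<^bsub>R\<^esub> d \<in> ?I" if "c \<in> ?I" "d \<in> ?I" for c d
      using that XC submoduleE(5)[OF N] by (simp add: smult_l_distr)
  qed auto
  show l: "d \<otimes>\<^bsub>R\<^esub> c \<in> ?I" if "c \<in> ?I" "d \<in> carrier R" for c d
    using that XC submoduleE(4)[OF N] by (simp add: smult_assoc1)
  show "c \<otimes>\<^bsub>R\<^esub> d \<in> ?I" if "c \<in> ?I" "d \<in> carrier R" for c d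
    using l[OF that] that R.m_comm[of c d] by simp
qed

text \<open>For a submodule \<open>X\<close> this is the product of the ideal generated by the first
  \<open>i\<close> elements with \<open>X\<close>. The recursion exposes the last summand, which is
  what the arguments on d-sequences split off.\<close>

primrec mult_sum :: "(nat \<Rightarrow> 'a) \<Rightarrow> nat \<Rightarrow> 'c set \<Rightarrow> 'c set"
  where "mult_sum a 0 X = {\<zero>\<^bsub>M\<^esub>}"
  | "mult_sum a (Suc i) X = mult_sum a i X <+>\<^bsub>M\<^esub> mult_image (a (Suc i)) X"

lemma sub_mult_sum: "a ` {1..i} \<subseteq> carrier R \<Longrightarrow> sub X \<Longrightarrow> sub (mult_sum a i X)"
proof (induction i)
  case (Suc i)
  then have "a (Suc i) \<in> carrier R" "a ` {1..i} \<subseteq> carrier R" by auto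
  then show ?case using Suc by (simp add: sub_add sub_mult_image)
qed (simp add: sub_trivial)

lemma mult_sum_mono: "X \<subseteq> Y \<Longrightarrow> mult_sum a i X \<subseteq> mult_sum a i Y"
proof (induction i)
  case (Suc i)
  then have "mult_image (a (Suc i)) X \<subseteq> mult_image (a (Suc i)) Y" by (auto simp: mult_image_def)
  then show ?case using Suc by (simp add: add_mono)
qed simp

lemma smult_mem_mult_sum:
  assumes "a ` {1..i} \<subseteq> carrier R" "sub X" "j \<in> {1..i}" "x \<in> X"
  shows "a j \<odot>\<^bsub>M\<^esub> x \<in> mult_sum a i X"
  using assms
proof (induction i)
  case (Suc i)
  then have c: "a (Suc i) \<in> carrier R" "a ` {1..i} \<subseteq> carrier R" by auto
  have s: "sub (mult_sum a i X)" "sub (mult_image (a (Suc i)) X)"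
    using c Suc.prems by (simp_all add: sub_mult_sum sub_mult_image)
  show ?case
  proof (cases "j = Suc i")
    case True
    then have "a j \<odot>\<^bsub>M\<^esub> x \<in> mult_image (a (Suc i)) X" using Suc.prems by (simp add: mult_image_def)
    then show ?thesis using add_ge2[OF s] by auto
  next
    case False
    then have "a j \<odot>\<^bsub>M\<^esub> x \<in> mult_sum a i X" using Suc c by auto
    then show ?thesis using add_ge1[OF s] by auto
  qed
qed simp

lemma mult_sum_least:
  assumes "sub N" "\<And>j x. j \<in> {1..i} \<Longrightarrow> x \<in> X \<Longrightarrow> a j \<odot>\<^bsub>M\<^esub> x \<in> N"
  shows "mult_sum a i X \<subseteq> N"
  using assms(2)
proof (induction i)
  case (Suc i)
  have "mult_sum a i X \<subseteq> N" by (rule Suc.IH) (use Suc.prems in auto)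
  moreover have "mult_image (a (Suc i)) X \<subseteq> N" using Suc.prems by (auto simp: mult_image_def)
  ultimately show ?case using assms(1) by (simp add: add_least)
qed (use assms(1) sub_zero in auto)

lemma ideal_smult_carrier: "ideal_smult R M (carrier R) = carrier M"
proof
  show "ideal_smult R M (carrier R) \<subseteq> carrier M" by (intro ideal_smult_leI sub_carrier) auto
  show "carrier M \<subseteq> ideal_smult R M (carrier R)"
    using smult_in_ideal_smult[of "\<one>\<^bsub>R\<^esub>" "carrier R"] by fastforce
qed

text \<open>This is (IJ)M = J(IM) for the ideal J of the sequence. It turns powers of an ideal
  acting on \<open>M\<close> into iterates of \<open>mult_sum\<close>.\<close>

lemma ideal_smult_ideal_prod:
  assumes a: "a ` {1..i} \<subseteq> carrier R" and I: "ideal I R"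
  shows "ideal_smult R M (ideal_prod R I (Idl\<^bsub>R\<^esub> (a ` {1..i}))) = mult_sum a i (ideal_smult R M I)"
proof
  let ?J = "Idl\<^bsub>R\<^esub> (a ` {1..i})" and ?X = "ideal_smult R M I"
  have IR: "I \<subseteq> carrier R" using I by (simp add: additive_subgroup.a_subset ideal.axioms(1))
  have X: "sub ?X" using IR by (rule sub_ideal_smult)
  have S: "sub (mult_sum a i ?X)" using a X by (rule sub_mult_sum)
  have J: "ideal ?J R" using a by (rule R.genideal_ideal)
  have IJ: "ideal_prod R I ?J \<subseteq> carrier R" using I J by (rule R.ideal_prod_in_carrier)
  have XC: "?X \<subseteq> carrier M" by (rule submoduleE(1)[OF X])
  \<comment> \<open>Membership in the generated ideal is not unfolded into linear combinations; the
    ideal is compared with an ideal quotient containing its generators.\<close>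
  have "?J \<subseteq> {c \<in> carrier R. \<forall>x\<in>?X. c \<odot>\<^bsub>M\<^esub> x \<in> mult_sum a i ?X}"
  proof (rule R.genideal_minimal[OF ideal_colon[OF S XC]], rule subsetI)
    fix c assume "c \<in> a ` {1..i}"
    then show "c \<in> {c \<in> carrier R. \<forall>x\<in>?X. c \<odot>\<^bsub>M\<^esub> x \<in> mult_sum a i ?X}"
      using a smult_mem_mult_sum[OF a X] by auto
  qed
  then have JX: "c \<odot>\<^bsub>M\<^esub> x \<in> mult_sum a i ?X" "c \<in> carrier R" if "c \<in> ?J" "x \<in> ?X" for c x
    using that by blast+
  show "ideal_smult R M (ideal_prod R I ?J) \<subseteq> mult_sum a i ?X"
  proof (rule ideal_smult_leI[OF S])
    fix c x assume c: "c \<in> ideal_prod R I ?J" and x: "x \<in> carrier M"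
    \<comment> \<open>The ring membership of \<open>c\<close> is carried along because the case of a
      sum needs it for distributivity.\<close>
    have "c \<in> carrier R \<and> c \<odot>\<^bsub>M\<^esub> x \<in> mult_sum a i ?X"
      using c
    proof induction
      case (prod d e)
      have d: "d \<in> carrier R" using prod IR by auto
      have dx: "d \<odot>\<^bsub>M\<^esub> x \<in> ?X" using prod x smult_in_ideal_smult by blast
      have e: "e \<in> carrier R" using JX(2)[OF prod(2) dx] .
      have "(d \<otimes>\<^bsub>R\<^esub> e) \<odot>\<^bsub>M\<^esub> x = e \<odot>\<^bsub>M\<^esub> (d \<odot>\<^bsub>M\<^esub> x)"
        using d e x by (subst R.m_comm) (simp_all add: smult_assoc1)
      then show ?case using JX(1)[OF prod(2) dx] d e by simp
    next
      case (sum c d)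
      then show ?case using x submoduleE(5)[OF S] by (simp add: smult_l_distr)
    qed
    then show "c \<odot>\<^bsub>M\<^esub> x \<in> mult_sum a i ?X" by simp
  qed
  show "mult_sum a i ?X \<subseteq> ideal_smult R M (ideal_prod R I ?J)"
  proof (rule mult_sum_least[OF sub_ideal_smult[OF IJ]])
    fix j x assume j: "j \<in> {1..i}" and x: "x \<in> ?X"
    have aj: "a j \<in> carrier R" using a j by auto
    \<comment> \<open>Fixing \<open>a j\<close> and taking a colon reduces the claim on IM to its
      generators.\<close>
    have "?X \<subseteq> colon M (ideal_smult R M (ideal_prod R I ?J)) (a j)"
    proof (rule ideal_smult_leI[OF sub_colon[OF sub_ideal_smult[OF IJ] aj]])
      fix c y assume c: "c \<in> I" and y: "y \<in> carrier M"
      then have cR: "c \<in> carrier R" using IR by auto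
      have "c \<otimes>\<^bsub>R\<^esub> a j \<in> ideal_prod R I ?J"
        using c R.genideal_self[OF a] j by (intro ideal_prod.prod) auto
      then have "(c \<otimes>\<^bsub>R\<^esub> a j) \<odot>\<^bsub>M\<^esub> y \<in> ideal_smult R M (ideal_prod R I ?J)"
        using y by (rule smult_in_ideal_smult)
      moreover have "(c \<otimes>\<^bsub>R\<^esub> a j) \<odot>\<^bsub>M\<^esub> y = a j \<odot>\<^bsub>M\<^esub> (c \<odot>\<^bsub>M\<^esub> y)"
        using cR aj y by (subst R.m_comm) (simp_all add: smult_assoc1)
      ultimately show "c \<odot>\<^bsub>M\<^esub> y \<in> colon M (ideal_smult R M (ideal_prod R I ?J)) (a j)"
        using cR y by (simp add: colon_def)
    qed
    then show "a j \<odot>\<^bsub>M\<^esub> x \<in> ideal_smult R M (ideal_prod R I ?J)" using x by (auto simp: colon_def)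
  qed
qed

lemma ideal_smult_genideal:
  assumes a: "a ` {1..i} \<subseteq> carrier R"
  shows "ideal_smult R M (Idl\<^bsub>R\<^esub> (a ` {1..i})) = mult_sum a i (carrier M)"
proof -
  have "ideal_prod R (carrier R) (Idl\<^bsub>R\<^esub> (a ` {1..i})) = Idl\<^bsub>R\<^esub> (a ` {1..i})"
    using R.ideal_prod_one R.ideal_prod_commute R.genideal_ideal[OF a] R.oneideal by metis
  then show ?thesis
    using ideal_smult_ideal_prod[OF a R.oneideal] by (simp add: ideal_smult_carrier)
qed


section \<open>Noetherian modules\<close>

text \<open>Well-foundedness of reverse inclusion yields a maximal member of every nonempty set of
  submodules, the form in which the Noetherian property is used below.\<close>

definition noetherian_module :: bool
  where "noetherian_module \<longleftrightarrow> wf {(X, Y). sub X \<and> sub Y \<and> Y \<subset> X}"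

lemma noetherian_maximal:
  assumes "noetherian_module" "X \<in> C" "\<And>X. X \<in> C \<Longrightarrow> sub X"
  obtains K where "K \<in> C" "\<And>X. X \<in> C \<Longrightarrow> K \<subseteq> X \<Longrightarrow> X = K"
proof -
  have "\<exists>K\<in>C. \<forall>X. (X, K) \<in> {(X, Y). sub X \<and> sub Y \<and> Y \<subset> X} \<longrightarrow> X \<notin> C"
    using assms(1,2) unfolding noetherian_module_def wf_eq_minimal by blast
  then show ?thesis using assms(3) that by blast
qed

lemma noetherian_stationary:
  fixes S :: "nat \<Rightarrow> 'c set"
  assumes "noetherian_module" "\<And>n. sub (S n)" "\<And>n. S n \<subseteq> S (Suc n)"
  obtains n where "S n = S (Suc n)"
proof -
  obtain K where K: "K \<in> range S" "\<And>X. X \<in> range S \<Longrightarrow> K \<subseteq> X \<Longrightarrow> X = K"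
    by (rule noetherian_maximal[OF assms(1), of "S 0" "range S"]) (use assms in auto)
  then obtain n where "K = S n" by auto
  then have "S (Suc n) = S n" using K(2)[of "S (Suc n)"] assms(3) by auto
  then show ?thesis using that[of n] by simp
qed

text \<open>One repetition per chain is enough, because a violation of well-foundedness is a chain
  that increases strictly at every step.\<close>

lemma noetherian_moduleI:
  assumes "\<And>S :: nat \<Rightarrow> 'c set. (\<And>n. sub (S n)) \<Longrightarrow> (\<And>n. S n \<subseteq> S (Suc n)) \<Longrightarrow> \<exists>n. S n = S (Suc n)"
  shows "noetherian_module"
  unfolding noetherian_module_def wf_iff_no_infinite_down_chain
proof
  assume "\<exists>f. \<forall>i. (f (Suc i), f i) \<in> {(X, Y). sub X \<and> sub Y \<and> Y \<subset> X}"
  then obtain f where f: "\<forall>i. sub (f (Suc i)) \<and> sub (f i) \<and> f i \<subset> f (Suc i)" by auto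
  then obtain n where "f n = f (Suc n)" using assms[of f] by blast
  then show False using f by blast
qed

definition cyclic :: "'c \<Rightarrow> 'c set"
  where "cyclic x = (\<lambda>c. c \<odot>\<^bsub>M\<^esub> x) ` carrier R"

lemma mem_cyclic: "x \<in> carrier M \<Longrightarrow> x \<in> cyclic x"
  unfolding cyclic_def by (rule image_eqI[of _ _ "\<one>\<^bsub>R\<^esub>"]) auto

lemma sub_cyclic:
  assumes x: "x \<in> carrier M"
  shows "sub (cyclic x)"
proof (rule submoduleI)
  show "\<zero>\<^bsub>M\<^esub> \<in> cyclic x" unfolding cyclic_def by (rule image_eqI[of _ _ "\<zero>\<^bsub>R\<^esub>"]) (use x in auto)
  show "\<ominus>\<^bsub>M\<^esub> y \<in> cyclic x" if y: "y \<in> cyclic x" for y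
  proof -
    obtain c where "c \<in> carrier R" "y = c \<odot>\<^bsub>M\<^esub> x" using y by (auto simp: cyclic_def)
    then show ?thesis
      unfolding cyclic_def by (intro image_eqI[of _ _ "\<ominus>\<^bsub>R\<^esub> c"]) (use x in \<open>auto simp: smult_l_minus\<close>)
  qed
  show "y \<oplus>\<^bsub>M\<^esub> z \<in> cyclic x" if yz: "y \<in> cyclic x" "z \<in> cyclic x" for y z
  proof -
    obtain c d where "c \<in> carrier R" "y = c \<odot>\<^bsub>M\<^esub> x" "d \<in> carrier R" "z = d \<odot>\<^bsub>M\<^esub> x"
      using yz by (auto simp: cyclic_def)
    then show ?thesis
      unfolding cyclic_def by (intro image_eqI[of _ _ "c \<oplus>\<^bsub>R\<^esub> d"]) (use x in \<open>auto simp: smult_l_distr\<close>)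
  qed
  show "s \<odot>\<^bsub>M\<^esub> y \<in> cyclic x" if sy: "s \<in> carrier R" "y \<in> cyclic x" for s y
  proof -
    obtain c where "c \<in> carrier R" "y = c \<odot>\<^bsub>M\<^esub> x" using sy by (auto simp: cyclic_def)
    then show ?thesis
      unfolding cyclic_def
      by (intro image_eqI[of _ _ "s \<otimes>\<^bsub>R\<^esub> c"]) (use x sy in \<open>auto simp: smult_assoc1\<close>)
  qed
qed (use x in \<open>auto simp: cyclic_def\<close>)

text \<open>The ascending chain condition for the submodule \<open>G\<close>, phrased with traces on
  \<open>G\<close> of chains in \<open>M\<close> so that all submodules live in one module.\<close>

definition acc_on :: "'c set \<Rightarrow> bool"
  where "acc_on G \<longleftrightarrow> (\<forall>S. (\<forall>n. sub (S n)) \<longrightarrow> (\<forall>n. S n \<subseteq> S (Suc n)) \<longrightarrow>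
    (\<exists>n. \<forall>m\<ge>n. S m \<inter> G = S n \<inter> G))"

text \<open>The quotient of the larger submodule by \<open>G\<close> is cyclic, so chains in it are
  governed by ideals of the ring. A chain whose traces on \<open>G\<close> and whose sums with
  \<open>G\<close> are stationary is itself stationary.\<close>

lemma acc_on_add_cyclic:
  assumes R: "noetherian_ring R" and G: "sub G" and st: "acc_on G" and x: "x \<in> carrier M"
  shows "acc_on (G <+>\<^bsub>M\<^esub> cyclic x)"
  unfolding acc_on_def
proof (intro allI impI)
  fix S assume S: "\<forall>n. sub (S n)" "\<forall>n. S n \<subseteq> S (Suc n)"
  let ?H = "G <+>\<^bsub>M\<^esub> cyclic x"
  have H: "sub ?H" by (intro sub_add G sub_cyclic x)
  have GH: "G \<subseteq> ?H" by (intro add_ge1 G sub_cyclic x)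
  have mono: "S n \<subseteq> S m" if "n \<le> m" for n m using S(2) that by (rule_tac lift_Suc_mono_le) auto
  define T where "T n = S n \<inter> ?H" for n
  have T: "sub (T n)" for n using S H by (simp add: T_def sub_Int)
  have Tmono: "T n \<subseteq> T m" if "n \<le> m" for n m using mono[OF that] by (auto simp: T_def)
  have TG: "sub (T n <+>\<^bsub>M\<^esub> G)" for n by (intro sub_add T G)
  obtain n1 where n1: "\<And>m. m \<ge> n1 \<Longrightarrow> S m \<inter> G = S n1 \<inter> G"
    using st S unfolding acc_on_def by blast
  \<comment> \<open>The ideal of coefficients of \<open>x\<close> that occur in \<open>T n\<close>
    modulo \<open>G\<close>. The increasing union of these ideals is one of them since the ring is
    Noetherian.\<close>
  define J where "J n = {c \<in> carrier R. \<forall>y\<in>{x}. c \<odot>\<^bsub>M\<^esub> y \<in> T n <+>\<^bsub>M\<^esub> G}" for n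
  have Jmono: "J n \<subseteq> J m" if "n \<le> m" for n m
    using add_mono[OF Tmono[OF that] order.refl, of G] by (auto simp: J_def)
  have "ideal (J n) R" for n unfolding J_def using x by (intro ideal_colon TG) simp
  moreover have "J n \<subseteq> J m \<or> J m \<subseteq> J n" for n m using Jmono[of n m] Jmono[of m n] by linarith
  ultimately have "subset.chain {I. ideal I R} (range J)"
    unfolding subset_chain_def by blast
  then have "\<Union>(range J) \<in> range J"
    by (intro noetherian_ring.ideal_chain_is_trivial[OF R]) auto
  then obtain n2 where n2: "\<Union>(range J) = J n2" by auto
  \<comment> \<open>Modulo \<open>G\<close> an element of \<open>T m\<close> is a multiple of
    \<open>x\<close>, and its coefficient lies in the largest ideal \<open>J n2\<close>.\<close>
  have T_le: "T m <+>\<^bsub>M\<^esub> G \<subseteq> T n2 <+>\<^bsub>M\<^esub> G" for m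
  proof (rule add_least[OF TG _ add_ge2[OF T G]])
    show "T m \<subseteq> T n2 <+>\<^bsub>M\<^esub> G"
    proof
      fix y assume y: "y \<in> T m"
      then obtain g c where gc: "g \<in> G" "c \<in> carrier R" "y = g \<oplus>\<^bsub>M\<^esub> c \<odot>\<^bsub>M\<^esub> x"
        by (auto simp: T_def set_add_iff cyclic_def)
      have car: "g \<in> carrier M" "c \<odot>\<^bsub>M\<^esub> x \<in> carrier M" using gc x sub_in_carrier[OF G] by auto
      have "y \<in> T m <+>\<^bsub>M\<^esub> G" "g \<in> T m <+>\<^bsub>M\<^esub> G"
        using y gc add_ge1[OF T G] add_ge2[OF T G] by blast+
      then have "c \<odot>\<^bsub>M\<^esub> x \<in> T m <+>\<^bsub>M\<^esub> G"
        using sub_add_cancel[OF TG _ car] gc(3) by simp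
      then have "c \<in> J n2" using n2 gc unfolding J_def by auto
      then have "c \<odot>\<^bsub>M\<^esub> x \<in> T n2 <+>\<^bsub>M\<^esub> G" by (simp add: J_def)
      moreover have "g \<in> T n2 <+>\<^bsub>M\<^esub> G" using gc add_ge2[OF T G] by blast
      ultimately show "y \<in> T n2 <+>\<^bsub>M\<^esub> G" unfolding gc(3) using submoduleE(5)[OF TG] by simp
    qed
  qed
  let ?n = "max n1 n2"
  have "T m = T ?n" if m: "m \<ge> ?n" for m
  proof (rule add_eq_of_modular[OF T T G, symmetric])
    show "T ?n \<subseteq> T m" using Tmono m by blast
    have "S m \<inter> G = S ?n \<inter> G" using n1[of m] n1[of ?n] m by simp
    then show "T ?n \<inter> G = T m \<inter> G" using GH by (auto simp: T_def)
    have "T n2 <+>\<^bsub>M\<^esub> G \<subseteq> T k <+>\<^bsub>M\<^esub> G" if "k \<ge> n2" for k using Tmono[OF that] by (intro add_mono) auto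
    then show "T ?n <+>\<^bsub>M\<^esub> G = T m <+>\<^bsub>M\<^esub> G"
      using T_le[of ?n] T_le[of m] m by (metis max.bounded_iff max.cobounded2 subset_antisym)
  qed
  then show "\<exists>n. \<forall>m\<ge>n. S m \<inter> ?H = S n \<inter> ?H" unfolding T_def by blast
qed

text \<open>The chain condition passes from the zero submodule to \<open>M\<close> by adjoining one
  generator at a time.\<close>

theorem fin_gen_imp_noetherian:
  assumes R: "noetherian_ring R" and fg: "fin_gen_module R M"
  shows "noetherian_module"
proof (rule noetherian_moduleI)
  obtain X where X: "finite X" "X \<subseteq> carrier M" "submodule_gen R M X = carrier M"
    using fg unfolding fin_gen_module_def by blast
  have "\<exists>G. sub G \<and> X \<subseteq> G \<and> acc_on G"
    using X(1,2)
  proof (induction X)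
    case empty
    have "acc_on {\<zero>\<^bsub>M\<^esub>}"
      unfolding acc_on_def using sub_zero by auto
    then show ?case using sub_trivial by blast
  next
    case (insert x X)
    then obtain G where G: "sub G" "X \<subseteq> G" "acc_on G" by auto
    have x: "x \<in> carrier M" using insert by simp
    have "insert x X \<subseteq> G <+>\<^bsub>M\<^esub> cyclic x"
      using add_ge1[OF G(1) sub_cyclic[OF x]] add_ge2[OF G(1) sub_cyclic[OF x]] mem_cyclic[OF x] G(2)
      by blast
    then show ?case
      using acc_on_add_cyclic[OF R G(1,3) x] sub_add[OF G(1) sub_cyclic[OF x]] by blast
  qed
  then obtain G where G: "sub G" "X \<subseteq> G" "acc_on G" by blast
  then have C: "carrier M \<subseteq> G" using submodule_gen_least[OF G(1,2)] X by simp
  fix S :: "nat \<Rightarrow> 'c set" assume S: "\<And>n. sub (S n)" "\<And>n. S n \<subseteq> S (Suc n)"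
  then obtain n where n: "\<forall>m\<ge>n. S m \<inter> G = S n \<inter> G" using G(3) unfolding acc_on_def by blast
  have "S (Suc n) \<inter> G = S n \<inter> G" using n[rule_format, of "Suc n"] by simp
  moreover have "S m \<inter> G = S m" for m using submoduleE(1)[OF S(1)] C by blast
  ultimately show "\<exists>n. S n = S (Suc n)" by metis
qed

end

section \<open>The filtration of a sequence\<close>

locale module_sequence = module R M for R (structure) and M (structure) +
  fixes a :: "nat \<Rightarrow> 'a" and r :: nat
  assumes seq_carrier: "a ` {1..r} \<subseteq> carrier R" and seq_nonempty: "r \<ge> 1"
begin

text \<open>\<open>Q n\<close> is \<open>\<qq>\<^sup>nM\<close> and \<open>Z i\<close> is \<open>\<qq>\<^sub>iM\<close> (\<open>Q_eq\<close>, \<open>Z_eq\<close>).\<close>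

primrec Q :: "nat \<Rightarrow> 'c set"
  where "Q 0 = carrier M"
  | "Q (Suc n) = mult_sum a r (Q n)"

definition Z :: "nat \<Rightarrow> 'c set"
  where "Z i = mult_sum a i (carrier M)"

lemma a_carrier: "i \<le> r \<Longrightarrow> a ` {1..i} \<subseteq> carrier R"
  using seq_carrier by (rule subset_trans[rotated]) auto

lemma a_closed: "i < r \<Longrightarrow> a (Suc i) \<in> carrier R"
  using seq_carrier by (simp add: image_subset_iff)

lemma sub_Q: "sub (Q n)"
  by (induction n) (use seq_carrier in \<open>simp_all add: sub_carrier sub_mult_sum\<close>)

lemma Q_decr: "Q (Suc n) \<subseteq> Q n"
proof (induction n)
  case 0
  then show ?case using submoduleE(1)[OF sub_Q[of 1]] by simp
next
  case (Suc n)
  then show ?case using mult_sum_mono by simp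
qed

lemma Q_antimono: "m \<le> n \<Longrightarrow> Q n \<subseteq> Q m"
  by (rule lift_Suc_antimono_le[of Q, OF Q_decr])

lemma sub_Z: "i \<le> r \<Longrightarrow> sub (Z i)"
  unfolding Z_def by (intro sub_mult_sum a_carrier sub_carrier)

lemma Z_0: "Z 0 = {\<zero>\<^bsub>M\<^esub>}"
  by (simp add: Z_def)

lemma Z_Suc: "Z (Suc i) = Z i <+>\<^bsub>M\<^esub> mult_image (a (Suc i)) (carrier M)"
  by (simp add: Z_def)

lemma Z_r: "Z r = Q 1"
  by (simp add: Z_def)

lemma Z_incr: "i < r \<Longrightarrow> Z i \<subseteq> Z (Suc i)"
  unfolding Z_Suc by (intro add_ge1 sub_Z sub_mult_image sub_carrier a_closed) auto

lemma Z_mono: "i \<le> j \<Longrightarrow> j \<le> r \<Longrightarrow> Z i \<subseteq> Z j"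
proof (induction j)
  case (Suc j)
  then show ?case using Z_incr[of j] by (cases "i = Suc j") auto
qed simp

lemma Z_le_Q1: "i \<le> r \<Longrightarrow> Z i \<subseteq> Q 1"
  using Z_mono[of i r] unfolding Z_r by simp

lemma smult_Q: "i < r \<Longrightarrow> x \<in> Q n \<Longrightarrow> a (Suc i) \<odot>\<^bsub>M\<^esub> x \<in> Q (Suc n)"
  using smult_mem_mult_sum[OF seq_carrier sub_Q, of "Suc i"] by simp

section \<open>Colons by powers of the ideal\<close>

text \<open>\<open>reach K s\<close> is \<open>K : \<qq>\<^sup>s\<close>.\<close>

primrec reach :: "'c set \<Rightarrow> nat \<Rightarrow> 'c set"
  where "reach K 0 = K"
  | "reach K (Suc s) = {x \<in> carrier M. \<forall>j\<in>{1..r}. a j \<odot>\<^bsub>M\<^esub> x \<in> reach K s}"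

lemma sub_reach: "sub K \<Longrightarrow> sub (reach K s)"
proof (induction s)
  case (Suc s)
  \<comment> \<open>The index set is nonempty because \<open>r \<ge> 1\<close>; an empty
    intersection would be the whole type instead of the carrier.\<close>
  have "reach K (Suc s) = \<Inter> ((\<lambda>j. colon M (reach K s) (a j)) ` {1..r})"
    using seq_nonempty by (force simp: colon_def)
  moreover have "sub \<dots>"
    using Suc seq_carrier seq_nonempty by (intro sub_Inter) (auto simp: image_subset_iff intro!: sub_colon)
  ultimately show ?case by simp
qed simp

lemma le_reach: "sub K \<Longrightarrow> K \<subseteq> reach K s"
proof (induction s)
  case (Suc s)
  then show ?case
    using seq_carrier submoduleE(4)[OF Suc.prems] sub_in_carrier[OF Suc.prems]
    by (auto simp: image_subset_iff subset_iff)
qed simp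

text \<open>The adjunction between multiplication by the ideal and the colon by it, applied one
  factor at a time.\<close>

lemma Q_le_of_reach: "sub K \<Longrightarrow> Q n \<subseteq> reach K s \<Longrightarrow> Q (n + s) \<subseteq> K"
proof (induction s arbitrary: n)
  case (Suc s)
  have "Q (Suc n) \<subseteq> reach K s"
    unfolding Q.simps using Suc.prems by (intro mult_sum_least sub_reach) auto
  then show ?case using Suc.IH[of "Suc n"] Suc.prems by simp
qed simp

text \<open>A pigeonhole argument on monomials of degree \<open>s\<close>. Multiplying
  \<open>x\<close> by \<open>a j\<close> lowers the exponent \<open>k j\<close> by one, and an
  exponent 0 puts the element into \<open>K\<close>; this must happen before the total degree is
  used up.\<close>

lemma mem_reach:
  assumes "sub K" "x \<in> carrier M" "(\<Sum>j\<in>{1..r}. k j) \<le> s"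
    and "\<And>j. j \<in> {1..r} \<Longrightarrow> (a j [^]\<^bsub>R\<^esub> (k j :: nat)) \<odot>\<^bsub>M\<^esub> x \<in> K"
  shows "x \<in> reach K s"
  using assms(2-4)
proof (induction s arbitrary: x k)
  case 0
  then show ?case using seq_nonempty "0.prems"(3)[of 1] by simp
next
  case (Suc s)
  show ?case
  proof (cases "\<exists>j\<in>{1..r}. k j = 0")
    case True
    then have "x \<in> K" using Suc.prems by force
    then show ?thesis using le_reach[OF assms(1)] by blast
  next
    case False
    have "a j \<odot>\<^bsub>M\<^esub> x \<in> reach K s" if j: "j \<in> {1..r}" for j
    proof (rule Suc.IH)
      have aR: "a l \<in> carrier R" if "l \<in> {1..r}" for l using seq_carrier that by auto
      show "a j \<odot>\<^bsub>M\<^esub> x \<in> carrier M" using Suc.prems aR[OF j] by simp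
      have "(\<Sum>i\<in>{1..r}. (k(j := k j - 1)) i) = (k j - 1) + sum k ({1..r} - {j})"
        using j by (subst sum.remove[of _ j]) auto
      moreover have "sum k {1..r} = k j + sum k ({1..r} - {j})" using j by (subst sum.remove[of _ j]) auto
      ultimately show "(\<Sum>i\<in>{1..r}. (k(j := k j - 1)) i) \<le> s" using Suc.prems(2) False j by force
      fix l assume l: "l \<in> {1..r}"
      show "(a l [^]\<^bsub>R\<^esub> ((k(j := k j - 1)) l)) \<odot>\<^bsub>M\<^esub> (a j \<odot>\<^bsub>M\<^esub> x) \<in> K"
      proof (cases "l = j")
        case True
        obtain k' where k': "k j = Suc k'"
          using \<open>\<not> (\<exists>j\<in>{1..r}. k j = 0)\<close> j not0_implies_Suc by blast
        have "(a j [^]\<^bsub>R\<^esub> k') \<odot>\<^bsub>M\<^esub> (a j \<odot>\<^bsub>M\<^esub> x) = (a j [^]\<^bsub>R\<^esub> k j) \<odot>\<^bsub>M\<^esub> x"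
          using aR[OF j] Suc.prems(1) k' by (simp add: smult_assoc1)
        then show ?thesis using Suc.prems(3)[OF j] True k' by simp
      next
        case False
        have "(a l [^]\<^bsub>R\<^esub> k l) \<odot>\<^bsub>M\<^esub> (a j \<odot>\<^bsub>M\<^esub> x) = a j \<odot>\<^bsub>M\<^esub> ((a l [^]\<^bsub>R\<^esub> k l) \<odot>\<^bsub>M\<^esub> x)"
          using aR[OF j] aR[OF l] Suc.prems(1) R.m_comm by (metis R.nat_pow_closed smult_assoc1)
        then show ?thesis
          using False submoduleE(4)[OF assms(1) aR[OF j] Suc.prems(3)[OF l]] by simp
      qed
    qed
    then show ?thesis using Suc.prems(1) by simp
  qed
qed

lemma Q_le_of_powers:
  assumes K: "sub K" and p: "\<And>j. j \<in> {1..r} \<Longrightarrow> \<exists>k::nat. \<forall>x\<in>carrier M. (a j [^]\<^bsub>R\<^esub> k) \<odot>\<^bsub>M\<^esub> x \<in> K"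
  obtains n where "Q n \<subseteq> K"
proof -
  obtain k :: "nat \<Rightarrow> nat" where "\<forall>j\<in>{1..r}. \<forall>x\<in>carrier M. (a j [^]\<^bsub>R\<^esub> k j) \<odot>\<^bsub>M\<^esub> x \<in> K"
    using p by metis
  then have "carrier M \<subseteq> reach K (\<Sum>j\<in>{1..r}. k j)"
    using mem_reach[OF K, of _ k] by blast
  then show ?thesis using Q_le_of_reach[OF K, of 0] that by force
qed

section \<open>Krull's intersection theorem\<close>

text \<open>
  A submodule \<open>K\<close> maximal with \<open>K \<inter> E \<subseteq> W\<close> contains \<open>a\<^sub>j\<^sup>kM\<close> for large \<open>k\<close>, because the chain
  \<open>K : a\<^sub>j\<^sup>k\<close> becomes stationary; hence it contains some \<open>Q n\<close>, and so \<open>E\<close> itself.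
\<close>

lemma Krull_step:
  assumes noeth: "noetherian_module" and N: "sub N"
  defines "E \<equiv> \<Inter>n. N <+>\<^bsub>M\<^esub> Q n"
  shows "E \<subseteq> N <+>\<^bsub>M\<^esub> mult_sum a r E"
proof -
  have NQ: "sub (N <+>\<^bsub>M\<^esub> Q n)" for n by (intro sub_add N sub_Q)
  have E: "sub E" unfolding E_def using NQ by (intro sub_Inter) auto
  have aE: "sub (mult_sum a r E)" by (intro sub_mult_sum seq_carrier E)
  define W where "W = N <+>\<^bsub>M\<^esub> mult_sum a r E"
  have W: "sub W" unfolding W_def by (intro sub_add N aE)
  obtain K where K: "K \<in> {K. sub K \<and> W \<subseteq> K \<and> K \<inter> E \<subseteq> W}"
    and max: "\<And>X. X \<in> {K. sub K \<and> W \<subseteq> K \<and> K \<inter> E \<subseteq> W} \<Longrightarrow> K \<subseteq> X \<Longrightarrow> X = K"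
    by (rule noetherian_maximal[OF noeth, of W "{K. sub K \<and> W \<subseteq> K \<and> K \<inter> E \<subseteq> W}"]) (use W in auto)
  then have K': "sub K" "W \<subseteq> K" "K \<inter> E \<subseteq> W" by auto
  obtain n where n: "Q n \<subseteq> K"
  proof (rule Q_le_of_powers[OF K'(1)])
    fix j assume j: "j \<in> {1..r}"
    then have aj: "a j \<in> carrier R" using seq_carrier by auto
    have pc: "a j [^]\<^bsub>R\<^esub> k \<in> carrier R" for k :: nat using aj by simp
    have shift: "(a j [^]\<^bsub>R\<^esub> Suc k) \<odot>\<^bsub>M\<^esub> x = a j \<odot>\<^bsub>M\<^esub> ((a j [^]\<^bsub>R\<^esub> k) \<odot>\<^bsub>M\<^esub> x)"
      if "x \<in> carrier M" for x and k :: nat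
      using aj pc[of k] that R.nat_pow_Suc2[OF aj, of k] by (simp only: smult_assoc1)
    obtain k :: nat where k: "colon M K (a j [^]\<^bsub>R\<^esub> k) = colon M K (a j [^]\<^bsub>R\<^esub> Suc k)"
    proof (rule noetherian_stationary[OF noeth, of "\<lambda>k. colon M K (a j [^]\<^bsub>R\<^esub> k)"])
      show "sub (colon M K (a j [^]\<^bsub>R\<^esub> k))" for k :: nat by (intro sub_colon K'(1) pc)
      show "colon M K (a j [^]\<^bsub>R\<^esub> k) \<subseteq> colon M K (a j [^]\<^bsub>R\<^esub> Suc k)" for k :: nat
        using submoduleE(4)[OF K'(1) aj] shift by (auto simp: colon_def simp del: R.nat_pow_Suc)
    qed
    let ?p = "a j [^]\<^bsub>R\<^esub> k"
    have pM: "sub (mult_image ?p (carrier M))" by (intro sub_mult_image sub_carrier pc)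
    \<comment> \<open>Let \<open>?p\<close> be the stationary power. For y = px + w in
      \<open>E\<close>, the product of \<open>a j\<close> with y lies in \<open>W\<close>, hence in
      \<open>K\<close>, so the next power maps x into \<open>K\<close>. By stationarity so does
      \<open>?p\<close>, and y lies in \<open>K\<close>. Maximality then absorbs pM into
      \<open>K\<close>.\<close>
    have "(mult_image ?p (carrier M) <+>\<^bsub>M\<^esub> K) \<inter> E \<subseteq> W"
    proof
      fix y assume y: "y \<in> (mult_image ?p (carrier M) <+>\<^bsub>M\<^esub> K) \<inter> E"
      then obtain x w where xw: "x \<in> carrier M" "w \<in> K" "y = ?p \<odot>\<^bsub>M\<^esub> x \<oplus>\<^bsub>M\<^esub> w"
        by (auto simp: set_add_iff mult_image_def)
      have w: "w \<in> carrier M" using xw sub_in_carrier[OF K'(1)] by blast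
      have px: "?p \<odot>\<^bsub>M\<^esub> x \<in> carrier M" using xw pc by simp
      have "a j \<odot>\<^bsub>M\<^esub> y \<in> mult_sum a r E"
        using y j by (intro smult_mem_mult_sum[OF seq_carrier E]) auto
      then have "a j \<odot>\<^bsub>M\<^esub> y \<in> K" using add_ge2[OF N aE] K'(2) unfolding W_def by blast
      moreover have "a j \<odot>\<^bsub>M\<^esub> y = a j \<odot>\<^bsub>M\<^esub> (?p \<odot>\<^bsub>M\<^esub> x) \<oplus>\<^bsub>M\<^esub> a j \<odot>\<^bsub>M\<^esub> w"
        unfolding xw(3) using aj px w by (simp add: smult_r_distr)
      ultimately have "a j \<odot>\<^bsub>M\<^esub> (?p \<odot>\<^bsub>M\<^esub> x) \<in> K"
        using sub_add_cancel[OF K'(1), of "a j \<odot>\<^bsub>M\<^esub> (?p \<odot>\<^bsub>M\<^esub> x)" "a j \<odot>\<^bsub>M\<^esub> w"]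
          submoduleE(4)[OF K'(1) aj xw(2)] aj px w by simp
      then have "x \<in> colon M K (a j [^]\<^bsub>R\<^esub> Suc k)" using shift[OF xw(1), of k] xw(1) unfolding colon_def by simp
      then have "x \<in> colon M K ?p" using k by blast
      then have "?p \<odot>\<^bsub>M\<^esub> x \<in> K" by (simp add: colon_def)
      then have "y \<in> K" unfolding xw(3) using xw(2) submoduleE(5)[OF K'(1)] by simp
      then show "y \<in> W" using y K'(3) by blast
    qed
    then have "mult_image ?p (carrier M) <+>\<^bsub>M\<^esub> K = K"
      using max[of "mult_image ?p (carrier M) <+>\<^bsub>M\<^esub> K"] sub_add[OF pM K'(1)] add_ge2[OF pM K'(1)] K'(2)
      by blast
    then have "mult_image ?p (carrier M) \<subseteq> K" using add_ge1[OF pM K'(1)] by simp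
    then show "\<exists>k::nat. \<forall>x\<in>carrier M. (a j [^]\<^bsub>R\<^esub> k) \<odot>\<^bsub>M\<^esub> x \<in> K"
      unfolding mult_image_def by blast
  qed
  have "E \<subseteq> N <+>\<^bsub>M\<^esub> Q n" unfolding E_def by blast
  also have "\<dots> \<subseteq> K"
    using add_least[OF K'(1) _ n] add_ge1[OF N aE] K'(2) unfolding W_def by blast
  finally show ?thesis using K'(3) unfolding W_def by blast
qed

text \<open>
  Nakayama's lemma without units: for \<open>K\<close> maximal among the submodules with \<open>N \<subseteq> K \<subset> E\<close> and
  \<open>x \<in> E - K\<close>, the ideal \<open>K : x\<close> is maximal because \<open>E/K\<close> is simple.
\<close>

lemma Nakayama:
  assumes noeth: "noetherian_module" and N: "sub N" and E: "sub E" and NE: "N \<subseteq> E"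
    and le: "E \<subseteq> N <+>\<^bsub>M\<^esub> mult_sum a r E"
    and local: "\<And>J. maximalideal J R \<Longrightarrow> a ` {1..r} \<subseteq> J"
  shows "E = N"
proof (rule ccontr)
  assume ne: "E \<noteq> N"
  obtain K where K: "K \<in> {K. sub K \<and> N \<subseteq> K \<and> K \<subset> E}"
    and max: "\<And>X. X \<in> {K. sub K \<and> N \<subseteq> K \<and> K \<subset> E} \<Longrightarrow> K \<subseteq> X \<Longrightarrow> X = K"
    by (rule noetherian_maximal[OF noeth, of N "{K. sub K \<and> N \<subseteq> K \<and> K \<subset> E}"]) (use N NE ne in auto)
  then have K': "sub K" "N \<subseteq> K" "K \<subset> E" by auto
  \<comment> \<open>Once the ideal maps \<open>E\<close> into \<open>K\<close>, the hypothesis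
    \<open>le\<close> forces \<open>E\<close> into \<open>K\<close>, against the choice of
    \<open>K\<close>.\<close>
  have "a j \<odot>\<^bsub>M\<^esub> x \<in> K" if j: "j \<in> {1..r}" and x: "x \<in> E" for j x
  proof (cases "x \<in> K")
    case True
    then show ?thesis using submoduleE(4)[OF K'(1)] j seq_carrier by (auto simp: image_subset_iff)
  next
    case False
    have xc: "x \<in> carrier M" using x sub_in_carrier[OF E] by blast
    define I where "I = {c \<in> carrier R. \<forall>y\<in>{x}. c \<odot>\<^bsub>M\<^esub> y \<in> K}"
    have I: "ideal I R" unfolding I_def using xc by (intro ideal_colon K'(1)) simp
    have "maximalideal I R"
    proof (rule maximalidealI[OF I])
      have "\<one>\<^bsub>R\<^esub> \<notin> I" using False xc by (simp add: I_def)
      then show "carrier R \<noteq> I" by auto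
      fix J assume J: "ideal J R" "I \<subseteq> J" "J \<subseteq> carrier R"
      show "J = I \<or> J = carrier R"
      proof (cases "J = I")
        case False
        then obtain b where b: "b \<in> J" "b \<notin> I" using J by blast
        have bc: "b \<in> carrier R" using b J by blast
        then have bx: "b \<odot>\<^bsub>M\<^esub> x \<notin> K" "b \<odot>\<^bsub>M\<^esub> x \<in> carrier M" "b \<odot>\<^bsub>M\<^esub> x \<in> E"
          using b xc x submoduleE(4)[OF E] by (simp_all add: I_def)
        \<comment> \<open>Maximality of \<open>K\<close> gives K + R(bx) = E, so x = k + tbx. Then 1
          - tb maps \<open>x\<close> into \<open>K\<close> and lies in \<open>I\<close>, while tb
          lies in \<open>J\<close>; thus \<open>J\<close> contains 1.\<close>
        let ?C = "cyclic (b \<odot>\<^bsub>M\<^esub> x)"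
        have C: "sub ?C" using bx by (intro sub_cyclic)
        have "?C \<subseteq> E" using bx submoduleE(4)[OF E] by (auto simp: cyclic_def)
        then have KCE: "K <+>\<^bsub>M\<^esub> ?C \<subseteq> E" using add_least[OF E] K'(3) by blast
        have "b \<odot>\<^bsub>M\<^esub> x \<in> K <+>\<^bsub>M\<^esub> ?C" using mem_cyclic[OF bx(2)] add_ge2[OF K'(1) C] by blast
        then have "K <+>\<^bsub>M\<^esub> ?C \<noteq> K" using bx by blast
        then have "K <+>\<^bsub>M\<^esub> ?C = E"
          using max[of "K <+>\<^bsub>M\<^esub> ?C"] KCE sub_add[OF K'(1) C] add_ge1[OF K'(1) C] K'(2) by blast
        then have "x \<in> K <+>\<^bsub>M\<^esub> ?C" using x by simp
        then obtain k t where kt: "k \<in> K" "t \<in> carrier R" "x = k \<oplus>\<^bsub>M\<^esub> t \<odot>\<^bsub>M\<^esub> (b \<odot>\<^bsub>M\<^esub> x)"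
          by (auto simp: set_add_iff cyclic_def)
        have kc: "k \<in> carrier M" using kt sub_in_carrier[OF K'(1)] by blast
        have tb: "t \<otimes>\<^bsub>R\<^esub> b \<in> J" "t \<otimes>\<^bsub>R\<^esub> b \<in> carrier R"
          using ideal.I_l_closed[OF J(1) b(1) kt(2)] J(3) by blast+
        have tbx: "(t \<otimes>\<^bsub>R\<^esub> b) \<odot>\<^bsub>M\<^esub> x = t \<odot>\<^bsub>M\<^esub> (b \<odot>\<^bsub>M\<^esub> x)"
          using kt(2) bc xc by (simp add: smult_assoc1)
        have tbc: "(t \<otimes>\<^bsub>R\<^esub> b) \<odot>\<^bsub>M\<^esub> x \<in> carrier M" using tb xc by simp
        have "x = k \<oplus>\<^bsub>M\<^esub> (t \<otimes>\<^bsub>R\<^esub> b) \<odot>\<^bsub>M\<^esub> x" unfolding tbx by (rule kt(3))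
        then have "x \<oplus>\<^bsub>M\<^esub> \<ominus>\<^bsub>M\<^esub> ((t \<otimes>\<^bsub>R\<^esub> b) \<odot>\<^bsub>M\<^esub> x)
            = (k \<oplus>\<^bsub>M\<^esub> (t \<otimes>\<^bsub>R\<^esub> b) \<odot>\<^bsub>M\<^esub> x) \<oplus>\<^bsub>M\<^esub> \<ominus>\<^bsub>M\<^esub> ((t \<otimes>\<^bsub>R\<^esub> b) \<odot>\<^bsub>M\<^esub> x)"
          by simp
        also have "\<dots> = k" using kc tbc M.r_neg M.a_assoc by simp
        finally have "(\<one>\<^bsub>R\<^esub> \<oplus>\<^bsub>R\<^esub> \<ominus>\<^bsub>R\<^esub> (t \<otimes>\<^bsub>R\<^esub> b)) \<odot>\<^bsub>M\<^esub> x = k"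
          using tb xc by (simp add: smult_l_distr smult_l_minus)
        then have "\<one>\<^bsub>R\<^esub> \<oplus>\<^bsub>R\<^esub> \<ominus>\<^bsub>R\<^esub> (t \<otimes>\<^bsub>R\<^esub> b) \<in> I" using kt(1) tb by (simp add: I_def)
        then have "(\<one>\<^bsub>R\<^esub> \<oplus>\<^bsub>R\<^esub> \<ominus>\<^bsub>R\<^esub> (t \<otimes>\<^bsub>R\<^esub> b)) \<oplus>\<^bsub>R\<^esub> t \<otimes>\<^bsub>R\<^esub> b \<in> J"
          using J tb additive_subgroup.a_closed[OF ideal.axioms(1)[OF J(1)]] by blast
        moreover have "(\<one>\<^bsub>R\<^esub> \<oplus>\<^bsub>R\<^esub> \<ominus>\<^bsub>R\<^esub> (t \<otimes>\<^bsub>R\<^esub> b)) \<oplus>\<^bsub>R\<^esub> t \<otimes>\<^bsub>R\<^esub> b = \<one>\<^bsub>R\<^esub>"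
          using tb(2) R.one_closed R.a_assoc R.l_neg R.r_zero R.a_inv_closed by metis
        ultimately show ?thesis using ideal.one_imp_carrier[OF J(1)] by simp
      qed simp
    qed
    then have "a j \<in> I" using local j by blast
    then show ?thesis by (simp add: I_def)
  qed
  then have "mult_sum a r E \<subseteq> K" by (intro mult_sum_least K'(1)) auto
  then have "E \<subseteq> K" using le add_least[OF K'(1,2)] by blast
  then show False using K'(3) by blast
qed

text \<open>Krull's theorem for M/N, pulled back to \<open>M\<close>: \<open>Krull_step\<close> puts
  the intersection E into N + qE, and Nakayama's lemma then gives E = N.\<close>

theorem Krull_intersection:
  assumes noeth: "noetherian_module" and N: "sub N"
    and local: "\<And>J. maximalideal J R \<Longrightarrow> a ` {1..r} \<subseteq> J"
  shows "(\<Inter>n. N <+>\<^bsub>M\<^esub> Q n) = N"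
proof (rule Nakayama[OF noeth N _ _ Krull_step[OF noeth N] local])
  show "sub (\<Inter>n. N <+>\<^bsub>M\<^esub> Q n)" using sub_add[OF N sub_Q] by (intro sub_Inter) auto
  show "N \<subseteq> (\<Inter>n. N <+>\<^bsub>M\<^esub> Q n)" using add_ge1[OF N sub_Q] by blast
qed

section \<open>Consequences of the d-sequence condition\<close>

text \<open>The hypothesis says that the sequence is a d-sequence on \<open>M\<close>.\<close>

lemma d_sequence_Int:
  assumes ds: "\<And>i. i < r \<Longrightarrow> colon M (Z i) (a (Suc i)) \<inter> Q 1 \<subseteq> Z i" and "i \<le> r"
  shows "Z i \<inter> Q (Suc n) \<subseteq> mult_sum a i (Q n)"
  using assms(2)
proof (induction n arbitrary: i)
  case 0
  then show ?case by (auto simp: Z_def)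
next
  case (Suc n)
  \<comment> \<open>Inside the induction on \<open>n\<close>, \<open>i\<close> descends from
    \<open>r\<close>, where the claim holds by the definition of \<open>Q\<close>.\<close>
  show ?case using Suc.prems
  proof (induction rule: inc_induct)
    case base
    then show ?case by auto
  next
    case (step i)
    have s: "sub (mult_sum a i (Q (Suc n)))" using step by (intro sub_mult_sum a_carrier sub_Q) auto
    show ?case
    proof
      fix x assume x: "x \<in> Z i \<inter> Q (Suc (Suc n))"
      then have "x \<in> mult_sum a (Suc i) (Q (Suc n))" using step Z_incr[of i] by blast
      then obtain y z where yz: "y \<in> mult_sum a i (Q (Suc n))" "z \<in> Q (Suc n)"
        "x = y \<oplus>\<^bsub>M\<^esub> a (Suc i) \<odot>\<^bsub>M\<^esub> z"
        by (auto simp: set_add_iff mult_image_def simp del: Q.simps)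
      have zc: "z \<in> carrier M" "a (Suc i) \<odot>\<^bsub>M\<^esub> z \<in> carrier M"
        using sub_in_carrier[OF sub_Q yz(2)] a_closed[of i] step by auto
      have yc: "y \<in> carrier M" using sub_in_carrier[OF s yz(1)] .
      have "mult_sum a i (Q (Suc n)) \<subseteq> Z i"
        unfolding Z_def by (intro mult_sum_mono submoduleE(1) sub_Q)
      then have "y \<in> Z i" using yz by blast
      then have "a (Suc i) \<odot>\<^bsub>M\<^esub> z \<in> Z i"
        using sub_add_cancel[OF sub_Z, of i y "a (Suc i) \<odot>\<^bsub>M\<^esub> z"] x yz(3) yc zc step by simp
      \<comment> \<open>The d-sequence condition moves \<open>z\<close> into \<open>Z i\<close>, and
        the outer induction hypothesis, one power lower, moves it into
        \<open>mult_sum a i (Q n)\<close>.\<close>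
      then have "z \<in> colon M (Z i) (a (Suc i))" using zc by (simp add: colon_def)
      moreover have "z \<in> Q 1" using yz(2) Q_antimono[of 1 "Suc n"] by auto
      ultimately have "z \<in> Z i \<inter> Q (Suc n)" using ds[of i] step yz(2) by blast
      then have z: "z \<in> mult_sum a i (Q n)" using Suc.IH[of i] step by auto
      \<comment> \<open>The ring is commutative, so multiplication by the next element can be
        applied to \<open>Q n\<close> first and raises the power there by one.\<close>
      have "mult_sum a i (Q n) \<subseteq> colon M (mult_sum a i (Q (Suc n))) (a (Suc i))"
      proof (rule mult_sum_least[OF sub_colon[OF s a_closed]])
        show "i < r" using step by simp
        fix j y assume j: "j \<in> {1..i}" and y: "y \<in> Q n"
        have c: "a j \<in> carrier R" "a (Suc i) \<in> carrier R" "y \<in> carrier M"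
          using a_carrier[of i] j a_closed[of i] step sub_in_carrier[OF sub_Q y] by auto
        have "a (Suc i) \<odot>\<^bsub>M\<^esub> (a j \<odot>\<^bsub>M\<^esub> y) = a j \<odot>\<^bsub>M\<^esub> (a (Suc i) \<odot>\<^bsub>M\<^esub> y)"
          using c by (metis R.m_comm smult_assoc1)
        also have "\<dots> \<in> mult_sum a i (Q (Suc n))"
          using step y j by (intro smult_mem_mult_sum a_carrier sub_Q smult_Q) auto
        finally show "a j \<odot>\<^bsub>M\<^esub> y \<in> colon M (mult_sum a i (Q (Suc n))) (a (Suc i))"
          using c by (simp add: colon_def)
      qed
      then have "a (Suc i) \<odot>\<^bsub>M\<^esub> z \<in> mult_sum a i (Q (Suc n))" using z by (auto simp: colon_def)
      then show "x \<in> mult_sum a i (Q (Suc n))" unfolding yz(3) using yz(1) submoduleE(5)[OF s] by simp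
    qed
  qed
qed

text \<open>If the product of \<open>x\<close> with the next element is u + v, then v lies in
  \<open>Z (Suc i)\<close> and in \<open>Q (Suc n)\<close>. \<open>d_sequence_Int\<close> writes v
  as an element of \<open>Z i\<close> plus a multiple of some z in \<open>Q n\<close> by the same
  element, so x - z lies in the colon of \<open>Z i\<close>.\<close>

lemma d_sequence_colon:
  assumes ds: "\<And>i. i < r \<Longrightarrow> colon M (Z i) (a (Suc i)) \<inter> Q 1 \<subseteq> Z i" and i: "i < r"
  shows "colon M (Z i <+>\<^bsub>M\<^esub> Q (Suc n)) (a (Suc i)) \<subseteq> colon M (Z i) (a (Suc i)) <+>\<^bsub>M\<^esub> Q n"
proof
  fix x assume x: "x \<in> colon M (Z i <+>\<^bsub>M\<^esub> Q (Suc n)) (a (Suc i))"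
  let ?b = "a (Suc i)"
  have b: "?b \<in> carrier R" using a_closed i .
  have xc: "x \<in> carrier M" using x by (simp add: colon_def)
  have Zi: "sub (Z i)" "sub (Z (Suc i))" using i sub_Z by auto
  obtain u v where uv: "u \<in> Z i" "v \<in> Q (Suc n)" "?b \<odot>\<^bsub>M\<^esub> x = u \<oplus>\<^bsub>M\<^esub> v"
    using x by (auto simp: colon_def set_add_iff)
  have uvc: "u \<in> carrier M" "v \<in> carrier M"
    using uv sub_in_carrier[OF Zi(1)] sub_in_carrier[OF sub_Q] by blast+
  have "?b \<odot>\<^bsub>M\<^esub> x \<in> Z (Suc i)"
    unfolding Z_def using i xc by (intro smult_mem_mult_sum a_carrier sub_carrier) auto
  then have "v \<in> Z (Suc i)"
    using sub_add_cancel[OF Zi(2), of u v] uv uvc Z_incr[OF i] by auto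
  then have "v \<in> mult_sum a (Suc i) (Q n)"
    using d_sequence_Int[OF ds, of "Suc i" n] uv(2) i by auto
  then obtain v' z where v'z: "v' \<in> mult_sum a i (Q n)" "z \<in> Q n" "v = v' \<oplus>\<^bsub>M\<^esub> ?b \<odot>\<^bsub>M\<^esub> z"
    by (auto simp: set_add_iff mult_image_def)
  have "mult_sum a i (Q n) \<subseteq> Z i"
    unfolding Z_def by (intro mult_sum_mono submoduleE(1) sub_Q)
  then have v': "v' \<in> Z i" using v'z by blast
  have c: "v' \<in> carrier M" "z \<in> carrier M"
    using v' sub_in_carrier[OF Zi(1)] v'z(2) sub_in_carrier[OF sub_Q] by blast+
  have "?b \<odot>\<^bsub>M\<^esub> (x \<ominus>\<^bsub>M\<^esub> z) = u \<oplus>\<^bsub>M\<^esub> v'"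
    unfolding smult_minus_distr[OF b xc c(2)] uv(3) v'z(3)
    using c uvc b by (simp add: a_minus_def M.a_assoc M.r_neg)
  then have "x \<ominus>\<^bsub>M\<^esub> z \<in> colon M (Z i) ?b"
    using submoduleE(5)[OF Zi(1) uv(1) v'] xc c by (simp add: colon_def)
  moreover have "x = (x \<ominus>\<^bsub>M\<^esub> z) \<oplus>\<^bsub>M\<^esub> z"
    using xc c by (simp add: a_minus_def M.a_assoc M.l_neg)
  ultimately show "x \<in> colon M (Z i) ?b <+>\<^bsub>M\<^esub> Q n" using v'z(2) unfolding set_add_iff by blast
qed

end

section \<open>The length recursion\<close>

context module_sequence
begin

declare Q.simps(2) [simp del]

definition B :: "nat \<Rightarrow> nat \<Rightarrow> 'c set"
  where "B i n = Z i <+>\<^bsub>M\<^esub> Q n"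

definition Zcolon :: "nat \<Rightarrow> 'c set"
  where "Zcolon i = colon M (Z i) (a (Suc i))"

text \<open>The colon is taken at \<open>Suc n\<close>: multiplication by a sequence element raises
  the power by one, so with this index \<open>B i n\<close> is contained in
  \<open>Bcolon i n\<close>.\<close>

definition Bcolon :: "nat \<Rightarrow> nat \<Rightarrow> 'c set"
  where "Bcolon i n = colon M (B i (Suc n)) (a (Suc i))"

lemma sub_B: "i \<le> r \<Longrightarrow> sub (B i n)"
  unfolding B_def by (intro sub_add sub_Z sub_Q)

lemma sub_Zcolon: "i < r \<Longrightarrow> sub (Zcolon i)"
  unfolding Zcolon_def by (intro sub_colon sub_Z a_closed) auto

lemma sub_Bcolon: "i < r \<Longrightarrow> sub (Bcolon i n)"
  unfolding Bcolon_def by (intro sub_colon sub_B a_closed) auto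

lemma B_0: "i \<le> r \<Longrightarrow> B i 0 = carrier M"
  unfolding B_def using add_absorb1[OF sub_Z sub_carrier] submoduleE(1)[OF sub_Z] by simp

lemma B_1: "i \<le> r \<Longrightarrow> B i 1 = Q 1"
  unfolding B_def by (intro add_absorb1 sub_Z sub_Q Z_le_Q1)

lemma B_r: "B r (Suc n) = Q 1"
  unfolding B_def Z_r by (intro add_absorb2 sub_Q Q_antimono) simp

lemma B_antimono: "m \<le> n \<Longrightarrow> B i n \<subseteq> B i m"
  unfolding B_def by (intro add_mono Q_antimono) auto

lemma B_le_Q1: "i \<le> r \<Longrightarrow> n \<ge> 1 \<Longrightarrow> B i n \<subseteq> Q 1"
  using B_antimono[of 1 n i] B_1 by simp

lemma B_le_Bcolon:
  assumes i: "i < r"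
  shows "B i n \<subseteq> Bcolon i n"
proof -
  have s: "sub (Z i)" "sub (B i (Suc n))" using i sub_Z sub_B by auto
  have "Z i \<subseteq> Bcolon i n"
    unfolding Bcolon_def colon_def B_def
    using add_ge1[OF s(1) sub_Q] submoduleE(1,4)[OF s(1)] a_closed[OF i] by blast
  moreover have "Q n \<subseteq> Bcolon i n"
    unfolding Bcolon_def colon_def B_def
    using add_ge2[OF s(1) sub_Q] submoduleE(1)[OF sub_Q] smult_Q[OF i] by blast
  ultimately show ?thesis unfolding B_def[of i n] by (intro add_least sub_Bcolon i)
qed

lemma Zcolon_le_Bcolon:
  assumes i: "i < r"
  shows "Zcolon i \<subseteq> Bcolon i n"
  unfolding Zcolon_def Bcolon_def B_def colon_def
  using add_ge1[OF sub_Z sub_Q, of i "Suc n"] i by auto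

text \<open>This form matches the upper end of the interval in \<open>len_colon\<close>.\<close>

lemma B_Suc: "i < r \<Longrightarrow> B (Suc i) n = mult_image (a (Suc i)) (carrier M) <+>\<^bsub>M\<^esub> B i n"
proof -
  assume i: "i < r"
  have s: "sub (mult_image (a (Suc i)) (carrier M))" "sub (Z i)" "sub (Z (Suc i))" "sub (B i n)"
    "sub (B (Suc i) n)"
    using i a_closed by (auto intro!: sub_mult_image sub_carrier sub_Z sub_B)
  show ?thesis
  proof
    show "B (Suc i) n \<subseteq> mult_image (a (Suc i)) (carrier M) <+>\<^bsub>M\<^esub> B i n"
      unfolding B_def[of "Suc i"] Z_Suc
      using add_ge1[OF s(1,4)] add_ge2[OF s(1,4)] add_ge1[OF s(2) sub_Q[of n]]
        add_ge2[OF s(2) sub_Q[of n]] unfolding B_def[of i, symmetric]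
      by (intro add_least sub_add s) auto
    show "mult_image (a (Suc i)) (carrier M) <+>\<^bsub>M\<^esub> B i n \<subseteq> B (Suc i) n"
    proof (rule add_least[OF s(5)])
      show "mult_image (a (Suc i)) (carrier M) \<subseteq> B (Suc i) n"
        using add_ge2[OF s(2,1)] add_ge1[OF s(3) sub_Q] unfolding B_def Z_Suc by blast
      show "B i n \<subseteq> B (Suc i) n" unfolding B_def by (intro add_mono Z_incr i order.refl)
    qed
  qed
qed

text \<open>The functions \<open>hlen\<close>, \<open>dlen\<close> and \<open>clen\<close> are the
  h, d and c of the opening text. They stay in \<open>enat\<close> until finiteness is
  known.\<close>

definition hlen :: "nat \<Rightarrow> nat \<Rightarrow> enat"
  where "hlen i n = len (B i n) (carrier M)"

definition dlen :: "nat \<Rightarrow> nat \<Rightarrow> enat"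
  where "dlen i n = len (B i n) (Bcolon i n)"

definition clen :: "nat \<Rightarrow> enat"
  where "clen i = len (Zcolon i \<inter> Q 1) (Zcolon i)"

text \<open>Multiplication by the next element maps M/\<open>Bcolon i n\<close> isomorphically onto
  \<open>B (Suc i) (Suc n)\<close>/\<open>B i (Suc n)\<close>. This common length \<open>?l\<close>
  is a summand of both \<open>hlen i n\<close> and \<open>hlen i (Suc n)\<close>. The additive form
  avoids subtracting infinite values.\<close>

lemma hlen_rec:
  assumes i: "i < r"
  shows "hlen i (Suc n) + dlen i n = hlen i n + hlen (Suc i) (Suc n)"
proof -
  let ?l = "len (Bcolon i n) (carrier M)"
  have B: "sub (B i n)" "sub (B i (Suc n))" "sub (B (Suc i) (Suc n))" "sub (Bcolon i n)"
    using i by (auto intro: sub_B sub_Bcolon)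
  have "B i (Suc n) \<subseteq> B (Suc i) (Suc n)"
    unfolding B_def by (intro add_mono Z_incr i order.refl)
  then have "hlen i (Suc n) = len (B i (Suc n)) (B (Suc i) (Suc n)) + hlen (Suc i) (Suc n)"
    unfolding hlen_def by (intro len_add B sub_carrier submoduleE(1))
  also have "len (B i (Suc n)) (B (Suc i) (Suc n)) = ?l"
    unfolding B_Suc[OF i] Bcolon_def using len_colon[OF B(2) a_closed[OF i]] by simp
  finally have 1: "hlen i (Suc n) = ?l + hlen (Suc i) (Suc n)" .
  have 2: "hlen i n = dlen i n + ?l"
    unfolding hlen_def dlen_def by (intro len_add B sub_carrier submoduleE(1) B_le_Bcolon i)
  show ?thesis unfolding 1 2 by (simp add: ac_simps)
qed

text \<open>For \<open>n \<ge> 1\<close> the interval can be cut at \<open>Q 1\<close>, since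
  \<open>B i n\<close> lies below it. The upper piece is moved above \<open>Q 1\<close> by the
  diamond isomorphism and cut again at \<open>Zcolon i\<close>. The two terms added to
  \<open>clen i\<close> measure the failure of two equalities of submodules.\<close>

lemma dlen_eq:
  assumes i: "i < r" and n: "n \<ge> 1"
  shows "dlen i n = clen i
    + (len (B i n) (Bcolon i n \<inter> Q 1) + len (Zcolon i <+>\<^bsub>M\<^esub> Q 1) (Bcolon i n <+>\<^bsub>M\<^esub> Q 1))"
proof -
  have s: "sub (B i n)" "sub (Bcolon i n)" "sub (Zcolon i)" "sub (Q 1)" "sub (Bcolon i n \<inter> Q 1)"
    "sub (Bcolon i n <+>\<^bsub>M\<^esub> Q 1)" "sub (Zcolon i <+>\<^bsub>M\<^esub> Q 1)"
    using i by (auto intro!: sub_B sub_Bcolon sub_Zcolon sub_Q sub_Int sub_add simp del: One_nat_def)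
  have "dlen i n = len (B i n) (Bcolon i n \<inter> Q 1) + len (Bcolon i n \<inter> Q 1) (Bcolon i n)"
    unfolding dlen_def using B_le_Bcolon[OF i] B_le_Q1[of i n] i n by (intro len_add s) auto
  also have "len (Bcolon i n \<inter> Q 1) (Bcolon i n) = len (Q 1) (Bcolon i n <+>\<^bsub>M\<^esub> Q 1)"
    using len_diamond[OF s(2,4)] by simp
  also have "\<dots> = len (Q 1) (Zcolon i <+>\<^bsub>M\<^esub> Q 1)
      + len (Zcolon i <+>\<^bsub>M\<^esub> Q 1) (Bcolon i n <+>\<^bsub>M\<^esub> Q 1)"
    by (intro len_add s add_ge2 add_mono Zcolon_le_Bcolon i order.refl)
  also have "len (Q 1) (Zcolon i <+>\<^bsub>M\<^esub> Q 1) = clen i"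
    unfolding clen_def by (rule len_diamond[OF s(3,4)])
  finally show ?thesis by (simp add: ac_simps)
qed

lemma clen_le_dlen: "i < r \<Longrightarrow> clen i \<le> dlen i (Suc n)"
  by (simp add: dlen_eq)

text \<open>The diamond isomorphism embeds the quotient measured by \<open>clen\<close> into M/qM,
  so it inherits finite length.\<close>

lemma clen_le_hlen: "i < r \<Longrightarrow> clen i \<le> hlen i 1"
proof -
  assume i: "i < r"
  have s: "sub (Zcolon i)" "sub (Q 1)" "sub (Zcolon i <+>\<^bsub>M\<^esub> Q 1)"
    using i by (auto intro!: sub_Zcolon sub_Q sub_add simp del: One_nat_def)
  have "B i 1 = Q 1" using B_1[of i] i by simp
  then have "hlen i 1 = len (Q 1) (Zcolon i <+>\<^bsub>M\<^esub> Q 1) + len (Zcolon i <+>\<^bsub>M\<^esub> Q 1) (carrier M)"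
    unfolding hlen_def by (simp only:) (intro len_add s sub_carrier add_ge2 submoduleE(1))
  then show ?thesis unfolding clen_def len_diamond[OF s(1,2), symmetric] by simp
qed

lemma dlen_le_hlen: "i < r \<Longrightarrow> dlen i n \<le> hlen i n"
proof -
  assume i: "i < r"
  then have "hlen i n = dlen i n + len (Bcolon i n) (carrier M)"
    unfolding hlen_def dlen_def
    by (intro len_add sub_B sub_Bcolon sub_carrier submoduleE(1) B_le_Bcolon) auto
  then show ?thesis by simp
qed

lemma hlen_0: "i \<le> r \<Longrightarrow> hlen i 0 = 0"
  by (simp add: hlen_def B_0 len_eq_0_iff sub_carrier)

lemma hlen_1: "i \<le> r \<Longrightarrow> hlen i 1 = len (Q 1) (carrier M)"
  by (simp add: hlen_def B_1 del: One_nat_def)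

lemma hlen_r: "hlen r (Suc n) = len (Q 1) (carrier M)"
  by (simp add: hlen_def B_r)

text \<open>Descending in \<open>i\<close> from M/qM and ascending in \<open>n\<close> from 0, the
  recursion bounds each length by two lengths already known to be finite.\<close>

lemma hlen_finite:
  assumes fin: "len (Q 1) (carrier M) < \<infinity>" and "i \<le> r"
  shows "hlen i n < \<infinity>"
  using assms(2)
proof (induction arbitrary: n rule: inc_induct)
  case base
  then show ?case using fin hlen_0[of r] hlen_r by (cases n) (auto simp del: One_nat_def)
next
  case (step i)
  show ?case
  proof (induction n)
    case 0
    then show ?case using step hlen_0[of i] by simp
  next
    case (Suc n)
    have "hlen i (Suc n) \<le> hlen i (Suc n) + dlen i n" by simp
    also have "\<dots> = hlen i n + hlen (Suc i) (Suc n)" by (rule hlen_rec) (use step in simp)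
    also have "\<dots> < \<infinity>" using Suc step.IH[of "Suc n"] by (auto simp: plus_eq_infty_iff_enat less_le)
    finally show ?case .
  qed
qed

text \<open>As \<open>clen i\<close> is finite it cancels in \<open>dlen_eq\<close>, so both
  remaining lengths must vanish. The first resulting equality is superficiality at level
  \<open>n\<close>.\<close>

lemma dlen_eq_clen_iff:
  assumes fin: "len (Q 1) (carrier M) < \<infinity>" and i: "i < r" and n: "n \<ge> 1"
  shows "dlen i n = clen i \<longleftrightarrow>
    Bcolon i n \<inter> Q 1 = B i n \<and> Bcolon i n <+>\<^bsub>M\<^esub> Q 1 = Zcolon i <+>\<^bsub>M\<^esub> Q 1"
proof -
  have "hlen i 1 < \<infinity>" using hlen_finite[OF fin, of i 1] i by simp
  then have "clen i < \<infinity>" by (rule le_less_trans[OF clen_le_hlen[OF i]])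
  then obtain k where k: "clen i = enat k" by auto
  have s: "sub (B i n)" "sub (Bcolon i n \<inter> Q 1)" "sub (Bcolon i n <+>\<^bsub>M\<^esub> Q 1)"
    "sub (Zcolon i <+>\<^bsub>M\<^esub> Q 1)"
    using i by (auto intro!: sub_B sub_Bcolon sub_Zcolon sub_Q sub_Int sub_add simp del: One_nat_def)
  have "dlen i n = clen i \<longleftrightarrow> len (B i n) (Bcolon i n \<inter> Q 1) = 0
      \<and> len (Zcolon i <+>\<^bsub>M\<^esub> Q 1) (Bcolon i n <+>\<^bsub>M\<^esub> Q 1) = 0"
    unfolding dlen_eq[OF i n] k
    by (cases "len (B i n) (Bcolon i n \<inter> Q 1)";
        cases "len (Zcolon i <+>\<^bsub>M\<^esub> Q 1) (Bcolon i n <+>\<^bsub>M\<^esub> Q 1)") (auto simp: zero_enat_def)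
  also have "len (B i n) (Bcolon i n \<inter> Q 1) = 0 \<longleftrightarrow> B i n = Bcolon i n \<inter> Q 1"
    using B_le_Bcolon[OF i] B_le_Q1[of i n] i n by (intro len_eq_0_iff s) auto
  also have "len (Zcolon i <+>\<^bsub>M\<^esub> Q 1) (Bcolon i n <+>\<^bsub>M\<^esub> Q 1) = 0
      \<longleftrightarrow> Zcolon i <+>\<^bsub>M\<^esub> Q 1 = Bcolon i n <+>\<^bsub>M\<^esub> Q 1"
    by (intro len_eq_0_iff s add_mono Zcolon_le_Bcolon i order.refl)
  finally show ?thesis by auto
qed

text \<open>Absolute superficiality pulled back from the quotients to \<open>M\<close>, with
  positions counted from 0; see \<open>absolutely_superficial_iff\<close>.\<close>

definition superficial :: bool
  where "superficial \<longleftrightarrow> (\<forall>i<r. \<forall>\<^sub>F n in sequentially. Bcolon i n \<inter> Q 1 = B i n)"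

text \<open>Superficiality speaks of large \<open>n\<close> only, whereas the equalities concern all
  \<open>n \<ge> 1\<close>. The gap is bridged by the d-sequence condition, in which
  \<open>n\<close> no longer occurs.\<close>

theorem superficial_iff:
  assumes fin: "len (Q 1) (carrier M) < \<infinity>" and noeth: "noetherian_module"
    and local: "\<And>J. maximalideal J R \<Longrightarrow> a ` {1..r} \<subseteq> J"
  shows "superficial \<longleftrightarrow> (\<forall>i<r. \<forall>n. dlen i (Suc n) = clen i)"
proof
  assume eq: "\<forall>i<r. \<forall>n. dlen i (Suc n) = clen i"
  show superficial
    unfolding superficial_def eventually_sequentially
  proof (intro allI impI exI)
    fix i n :: nat assume "i < r" "1 \<le> n"
    then show "Bcolon i n \<inter> Q 1 = B i n"
      using dlen_eq_clen_iff[OF fin, of i n] eq[rule_format, of i "n - 1"] by simp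
  qed
next
  assume sup: superficial
  have ds: "colon M (Z i) (a (Suc i)) \<inter> Q 1 \<subseteq> Z i" if i: "i < r" for i
  proof -
    obtain n0 where n0: "\<And>n. n \<ge> n0 \<Longrightarrow> Bcolon i n \<inter> Q 1 = B i n"
      using sup i unfolding superficial_def eventually_sequentially by blast
    \<comment> \<open>Superficiality is applied at an index beyond both \<open>n\<close> and
      \<open>n0\<close>; since \<open>B i\<close> is decreasing, every \<open>n\<close> is
      covered.\<close>
    have "Zcolon i \<inter> Q 1 \<subseteq> Z i <+>\<^bsub>M\<^esub> Q n" for n
    proof -
      have "Zcolon i \<inter> Q 1 \<subseteq> B i (max n n0)"
        using Zcolon_le_Bcolon[OF i, of "max n n0"] n0[of "max n n0"] by auto
      also have "\<dots> \<subseteq> B i n" by (rule B_antimono) simp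
      finally show ?thesis unfolding B_def .
    qed
    then have "Zcolon i \<inter> Q 1 \<subseteq> (\<Inter>n. Z i <+>\<^bsub>M\<^esub> Q n)" by blast
    also have "\<dots> = Z i" by (rule Krull_intersection[OF noeth sub_Z local]) (use i in auto)
    finally show ?thesis unfolding Zcolon_def .
  qed
  show "\<forall>i<r. \<forall>n. dlen i (Suc n) = clen i"
  proof (intro allI impI)
    fix i n assume i: "i < r"
    have s: "sub (Zcolon i)" "sub (Q (Suc n))" "sub (Q 1)" "sub (Z i)" "sub (B i (Suc n))"
      "sub (Zcolon i \<inter> Q 1)" "sub (Zcolon i <+>\<^bsub>M\<^esub> Q 1)"
      using i sub_Zcolon[OF i] sub_Q sub_Z sub_B by (auto intro!: sub_Int sub_add simp del: Q.simps One_nat_def)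
    have Q1: "Q (Suc n) \<subseteq> Q 1" by (rule Q_antimono) simp
    have le: "Bcolon i (Suc n) \<subseteq> Zcolon i <+>\<^bsub>M\<^esub> Q (Suc n)"
      using d_sequence_colon[OF ds i, of "Suc n"] unfolding Bcolon_def Zcolon_def B_def .
    \<comment> \<open>Because \<open>Q (Suc n)\<close> lies in \<open>Q 1\<close>, the modular law
      moves the intersection onto \<open>Zcolon i\<close>, where the d-sequence condition
      applies.\<close>
    have "Bcolon i (Suc n) \<inter> Q 1 \<subseteq> (Q (Suc n) <+>\<^bsub>M\<^esub> Zcolon i) \<inter> Q 1"
      using le add_least[OF sub_add[OF s(2,1)] add_ge2[OF s(2,1)] add_ge1[OF s(2,1)]] by blast
    also have "\<dots> = Q (Suc n) <+>\<^bsub>M\<^esub> (Zcolon i \<inter> Q 1)"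
      by (rule modular_law[OF s(2,1,3) Q1])
    also have "\<dots> \<subseteq> B i (Suc n)"
    proof (rule add_least[OF s(5)])
      show "Q (Suc n) \<subseteq> B i (Suc n)" unfolding B_def by (rule add_ge2[OF s(4,2)])
      show "Zcolon i \<inter> Q 1 \<subseteq> B i (Suc n)"
        using ds[OF i] add_ge1[OF s(4,2)] unfolding B_def Zcolon_def by blast
    qed
    finally have 1: "Bcolon i (Suc n) \<inter> Q 1 = B i (Suc n)"
      using B_le_Bcolon[OF i, of "Suc n"] B_le_Q1[of i "Suc n"] i by (auto simp del: Q.simps One_nat_def)
    have "Bcolon i (Suc n) \<subseteq> Zcolon i <+>\<^bsub>M\<^esub> Q 1"
      using le add_mono[OF order.refl Q1, of "Zcolon i"] by blast
    then have "Bcolon i (Suc n) <+>\<^bsub>M\<^esub> Q 1 \<subseteq> Zcolon i <+>\<^bsub>M\<^esub> Q 1"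
      by (intro add_least s add_ge2)
    moreover have "Zcolon i <+>\<^bsub>M\<^esub> Q 1 \<subseteq> Bcolon i (Suc n) <+>\<^bsub>M\<^esub> Q 1"
      by (intro add_mono Zcolon_le_Bcolon i order.refl)
    ultimately show "dlen i (Suc n) = clen i"
      using 1 dlen_eq_clen_iff[OF fin i, of "Suc n"] by simp
  qed
qed

end


section \<open>Solving the recursion\<close>

text \<open>Abel summation: by Pascal's rule the difference of the consecutive binomials multiplying
  \<open>c k\<close> is \<open>(n + k) choose Suc k\<close>.\<close>

lemma choose_sum_by_parts:
  fixes c :: "nat \<Rightarrow> int"
  shows "(\<Sum>k=1..r. int ((n + k) choose k) * (c k - c (k - 1))) + c 0
    = int ((n + r) choose r) * c r - (\<Sum>k<r. int ((n + k) choose Suc k) * c k)"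
proof (induction r)
  case (Suc r)
  have "int ((n + Suc r) choose Suc r) = int ((n + r) choose r) + int ((n + r) choose Suc r)" by simp
  then show ?case using Suc by (simp add: algebra_simps)
qed simp

text \<open>The recursion over the integers. The index of \<open>g\<close> is shifted,
  \<open>g i n\<close> standing for h_i(n+1), while \<open>d\<close> keeps its own. All
  \<open>g i 0\<close> then equal l(M/qM), and only values d_i(n) with n at least 1 occur, those for
  which c_i is a lower bound.\<close>

locale length_recursion =
  fixes g d :: "nat \<Rightarrow> nat \<Rightarrow> int" and c :: "nat \<Rightarrow> int" and l :: int and r :: nat
  assumes g_r: "g r n = l" and g_0: "i \<le> r \<Longrightarrow> g i 0 = l"
    and g_Suc: "i < r \<Longrightarrow> g i (Suc n) + d i (Suc n) = g i n + g (Suc i) (Suc n)"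
    and d_ge: "i < r \<Longrightarrow> c i \<le> d i (Suc n)"
begin

text \<open>The solution of the recursion with \<open>c\<close> in place of \<open>d\<close> and
  boundary values \<open>l\<close>. For \<open>i = 0\<close> it is the polynomial of the
  theorem.\<close>

definition P :: "nat \<Rightarrow> nat \<Rightarrow> int"
  where "P i n = int ((n + (r - i)) choose (r - i)) * l
    - (\<Sum>j=i..<r. int ((n + (j - i)) choose Suc (j - i)) * c j)"

lemma P_Suc:
  assumes i: "i < r"
  shows "P i (Suc n) = P i n + P (Suc i) (Suc n) - c i"
proof -
  obtain k where k: "r - i = Suc k" "r - Suc i = k" using i by (metis Suc_diff_Suc)
  \<comment> \<open>Pascal's rule in each summand.\<close>
  have "(\<Sum>j=i..<r. int ((Suc n + (j - i)) choose Suc (j - i)) * c j)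
      - (\<Sum>j=i..<r. int ((n + (j - i)) choose Suc (j - i)) * c j)
      = (\<Sum>j=i..<r. int ((n + (j - i)) choose (j - i)) * c j)"
    by (simp add: sum_subtractf[symmetric] algebra_simps)
  also have "\<dots> = c i + (\<Sum>j=Suc i..<r. int ((n + (j - i)) choose (j - i)) * c j)"
    using i by (subst sum.atLeast_Suc_lessThan) auto
  \<comment> \<open>For \<open>j > i\<close> the numbers j - i and j - (i + 1) differ by one, so
    these are the binomials of \<open>P (Suc i) (Suc n)\<close>; the split-off term
    \<open>c i\<close> remains.\<close>
  also have "(\<Sum>j=Suc i..<r. int ((n + (j - i)) choose (j - i)) * c j)
      = (\<Sum>j=Suc i..<r. int ((Suc n + (j - Suc i)) choose Suc (j - Suc i)) * c j)"
  proof (rule sum.cong)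
    fix j assume "j \<in> {Suc i..<r}"
    then have "j - i = Suc (j - Suc i)" by auto
    then show "int ((n + (j - i)) choose (j - i)) * c j
        = int ((Suc n + (j - Suc i)) choose Suc (j - Suc i)) * c j" by simp
  qed simp
  finally show ?thesis unfolding P_def k by (simp add: algebra_simps)
qed

definition D :: "nat \<Rightarrow> nat \<Rightarrow> int"
  where "D i n = P i n - g i n"

lemma D_r: "D r n = 0"
  by (simp add: D_def P_def g_r)

lemma D_0: "i \<le> r \<Longrightarrow> D i 0 = 0"
  by (simp add: D_def P_def g_0 binomial_eq_0)

lemma D_Suc: "i < r \<Longrightarrow> D i (Suc n) = D i n + D (Suc i) (Suc n) + (d i (Suc n) - c i)"
  using g_Suc[of i n] P_Suc[of i n] by (simp add: D_def)

text \<open>All summands in \<open>D_Suc\<close> are nonnegative, by descent in \<open>i\<close>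
  from \<open>r\<close> and ascent in \<open>n\<close> from 0.\<close>

lemma D_nonneg: "i \<le> r \<Longrightarrow> D i n \<ge> 0"
proof (induction arbitrary: n rule: inc_induct)
  case base
  then show ?case by (simp add: D_r)
next
  case (step i)
  show ?case
  proof (induction n)
    case 0
    then show ?case using step D_0[of i] by simp
  next
    case (Suc n)
    then show ?case using D_Suc[of i n] step.IH[of "Suc n"] d_ge[of i n] step by simp
  qed
qed

lemma D_mono: "i < r \<Longrightarrow> m \<le> n \<Longrightarrow> D i m \<le> D i n"
proof (rule lift_Suc_mono_le[of "D i"])
  assume i: "i < r"
  then have "D (Suc i) (Suc n) \<ge> 0" for n by (intro D_nonneg) simp
  then show "D i n \<le> D i (Suc n)" for n
    using D_Suc[OF i, of n] d_ge[OF i, of n] by (simp add: add_increasing add_increasing2)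
qed

text \<open>A sum of nonnegative terms vanishes only if each term does. So the vanishing of
  \<open>D i\<close> splits into that of \<open>D (Suc i)\<close> and equality of \<open>d i\<close>
  with \<open>c i\<close>, and the descent continues up to \<open>D r = 0\<close>.\<close>

lemma D_eq_0_iff:
  assumes "i \<le> r"
  shows "(\<forall>n. D i n = 0) \<longleftrightarrow> (\<forall>k. i \<le> k \<longrightarrow> k < r \<longrightarrow> (\<forall>n. d k (Suc n) = c k))"
  using assms
proof (induction rule: inc_induct)
  case base
  then show ?case by (auto simp: D_r)
next
  case (step i)
  then have i: "i < r" by simp
  have "(\<forall>n. D i n = 0) \<longleftrightarrow> (\<forall>n. D (Suc i) n = 0) \<and> (\<forall>n. d i (Suc n) = c i)"
  proof
    assume 0: "\<forall>n. D i n = 0"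
    have "D (Suc i) (Suc n) = 0 \<and> d i (Suc n) = c i" for n
      using D_Suc[OF i, of n] 0 D_nonneg[of "Suc i" "Suc n"] d_ge[OF i, of n] i by simp
    moreover have "D (Suc i) 0 = 0" using i by (simp add: D_0)
    ultimately show "(\<forall>n. D (Suc i) n = 0) \<and> (\<forall>n. d i (Suc n) = c i)" by (metis not0_implies_Suc)
  next
    assume 0: "(\<forall>n. D (Suc i) n = 0) \<and> (\<forall>n. d i (Suc n) = c i)"
    have "D i n = 0" for n
      by (induction n) (use D_0[of i] D_Suc[OF i] 0 i in auto)
    then show "\<forall>n. D i n = 0" by simp
  qed
  moreover have "(\<forall>k. i \<le> k \<longrightarrow> k < r \<longrightarrow> X k) \<longleftrightarrow> (\<forall>k. Suc i \<le> k \<longrightarrow> k < r \<longrightarrow> X k) \<and> X i" for X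
    using i Suc_le_eq le_eq_less_or_eq by metis
  ultimately show ?case unfolding step.IH by presburger
qed

lemma bound: "g 0 n \<le> P 0 n"
  using D_nonneg[of 0 n] by (simp add: D_def)

text \<open>\<open>D 0\<close> is nonnegative and nondecreasing, so infinitely many zeros force it to vanish.\<close>

lemma infinite_equality_iff:
  assumes "r \<ge> 1"
  shows "infinite {n. g 0 n = P 0 n} \<longleftrightarrow> (\<forall>i<r. \<forall>n. d i (Suc n) = c i)"
proof -
  have "infinite {n. D 0 n = 0} \<longleftrightarrow> (\<forall>n. D 0 n = 0)"
  proof
    assume inf: "infinite {n. D 0 n = 0}"
    show "\<forall>n. D 0 n = 0"
    proof
      fix n
      obtain m where "m > n" "D 0 m = 0"
        using inf unfolding infinite_nat_iff_unbounded by blast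
      then show "D 0 n = 0" using D_mono[of 0 n m] D_nonneg[of 0 n] assms by simp
    qed
  qed simp
  moreover have "{n. g 0 n = P 0 n} = {n. D 0 n = 0}" by (auto simp: D_def)
  ultimately show ?thesis unfolding D_eq_0_iff[OF le0] by simp
qed

end

section \<open>The coefficients and the main theorem\<close>

context module_sequence
begin

lemma Z_eq: "i \<le> r \<Longrightarrow> ideal_smult R M (seq_ideal R a i) = Z i"
  unfolding seq_ideal_def Z_def by (intro ideal_smult_genideal a_carrier)

lemma ideal_seq_ideal: "ideal (seq_ideal R a r) R"
  unfolding seq_ideal_def by (intro R.genideal_ideal seq_carrier)

lemma power_Suc_ideal:
  "I [^]\<^bsub>ideals_set R\<^esub> Suc n = ideal_prod R (I [^]\<^bsub>ideals_set R\<^esub> n) I"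
  by (simp add: nat_pow_def ideals_set_def)

lemma power_ideal: "ideal (seq_ideal R a r [^]\<^bsub>ideals_set R\<^esub> (n::nat)) R"
proof (induction n)
  case 0
  then show ?case using R.oneideal by (simp add: nat_pow_def ideals_set_def)
next
  case (Suc n)
  then show ?case unfolding power_Suc_ideal by (intro R.ideal_prod_is_ideal ideal_seq_ideal)
qed

lemma Q_eq: "ideal_smult R M (seq_ideal R a r [^]\<^bsub>ideals_set R\<^esub> (n::nat)) = Q n"
proof (induction n)
  case 0
  then show ?case by (simp add: nat_pow_def ideals_set_def ideal_smult_carrier)
next
  case (Suc n)
  have "ideal_smult R M (ideal_prod R (seq_ideal R a r [^]\<^bsub>ideals_set R\<^esub> n) (seq_ideal R a r))
      = mult_sum a r (ideal_smult R M (seq_ideal R a r [^]\<^bsub>ideals_set R\<^esub> n))"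
    using ideal_smult_ideal_prod[OF seq_carrier power_ideal[of n]] unfolding seq_ideal_def .
  then show ?case unfolding power_Suc_ideal Suc Q.simps(2) .
qed

text \<open>Every submodule in the condition is the image of one containing \<open>Z k\<close>, and
  images of such submodules agree only if the submodules do. The equation can therefore be tested in
  \<open>M\<close>.\<close>

lemma absolutely_superficial_iff: "absolutely_superficial R M r a \<longleftrightarrow> superficial"
proof -
  let ?q = "seq_ideal R a r"
  have *: "(let L = quot_module M (ideal_smult R M (seq_ideal R a (Suc k - 1))) in
       \<forall>\<^sub>F n in sequentially.
         colon L (ideal_smult R L (?q [^]\<^bsub>ideals_set R\<^esub> (n + 1))) (a (Suc k)) \<inter> ideal_smult R L ?q
           = ideal_smult R L (?q [^]\<^bsub>ideals_set R\<^esub> n))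
      \<longleftrightarrow> (\<forall>\<^sub>F n in sequentially. Bcolon k n \<inter> Q 1 = B k n)" if k: "k < r" for k
  proof -
    let ?L = "quot_module M (Z k)" and ?\<pi> = "\<lambda>x. Z k +>\<^bsub>M\<^esub> x"
    have N: "sub (Z k)" using sub_Z k by simp
    have Q1: "Z k \<subseteq> Q 1" using k by (intro Z_le_Q1) simp
    have ZB: "Z k \<subseteq> B k n" for n unfolding B_def by (intro add_ge1 N sub_Q)
    have carr: "I \<subseteq> carrier R" if "ideal I R" for I
      using that by (simp add: additive_subgroup.a_subset ideal.axioms(1))
    have pow: "ideal_smult R ?L (?q [^]\<^bsub>ideals_set R\<^esub> n) = ?\<pi> ` B k n" for n :: nat
      unfolding quot_ideal_smult[OF N carr[OF power_ideal]] Q_eq B_def ..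
    have q: "ideal_smult R ?L ?q = ?\<pi> ` Q 1"
      unfolding quot_ideal_smult[OF N carr[OF ideal_seq_ideal]] Z_eq[OF order.refl] Z_r
      using add_absorb1[OF N sub_Q Q1] by simp
    have "colon ?L (ideal_smult R ?L (?q [^]\<^bsub>ideals_set R\<^esub> (n + 1))) (a (Suc k)) \<inter> ideal_smult R ?L ?q
        = ideal_smult R ?L (?q [^]\<^bsub>ideals_set R\<^esub> n)
      \<longleftrightarrow> Bcolon k n \<inter> Q 1 = B k n" for n
    proof -
      have sB: "sub (B k n)" "sub (B k (Suc n))" "sub (Bcolon k n)"
        using sub_B sub_Bcolon k by simp_all
      have ZC: "Z k \<subseteq> Bcolon k n" using ZB B_le_Bcolon[OF k] by blast
      have "colon ?L (ideal_smult R ?L (?q [^]\<^bsub>ideals_set R\<^esub> (n + 1))) (a (Suc k)) = ?\<pi> ` Bcolon k n"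
        unfolding pow Bcolon_def using quot_colon[OF N sB(2) ZB a_closed[OF k]] by simp
      then have "colon ?L (ideal_smult R ?L (?q [^]\<^bsub>ideals_set R\<^esub> (n + 1))) (a (Suc k)) \<inter> ideal_smult R ?L ?q
          = ?\<pi> ` (Bcolon k n \<inter> Q 1)"
        unfolding q using coset_image_Int[OF N sB(3) sub_Q ZC Q1] by simp
      then show ?thesis
        unfolding pow
        using coset_image_eq_iff[OF N sub_Int[OF sB(3) sub_Q] _ sB(1) ZB] ZC Q1 by simp
    qed
    moreover have "ideal_smult R M (seq_ideal R a (Suc k - 1)) = Z k" using Z_eq[of k] k by simp
    ultimately show ?thesis unfolding Let_def by simp
  qed
  \<comment> \<open>Positions in the sequence start at 1, levels of the filtration at 0.\<close>
  have "{1..r} = Suc ` {..<r}" by (auto simp: image_iff Bex_def) presburger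
  then show ?thesis
    unfolding absolutely_superficial_def superficial_def Let_def[of ?q]
    using * by (simp only: ball_simps) blast
qed

lemma colon_length_clen:
  assumes j: "j < r"
  shows "colon_length R M (Z r) (Z j) (a (Suc j)) = int (the_enat (clen j))"
  unfolding colon_length_def clen_def Z_r Zcolon_def[symmetric]
  by (subst subquot_length_len) (auto intro!: sub_Zcolon sub_Int sub_Q j)

text \<open>The value at \<open>r\<close> makes \<open>e\<^sub>0\<close> a difference of consecutive values like the other \<open>e\<^sub>i\<close>.\<close>

definition e_ext :: "nat \<Rightarrow> int"
  where "e_ext k = int (the_enat (if k < r then clen k else len (Q 1) (carrier M)))"

text \<open>The coefficients run through the levels backwards. With the extra value at
  \<open>r\<close> the first two clauses of the definition become one, and only the last coefficient
  has no subtrahend.\<close>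

lemma e_coeff_eq:
  assumes "i \<le> r"
  shows "e_coeff R M r a i = (if i = r then e_ext 0 else e_ext (r - i) - e_ext (r - i - 1))"
proof -
  have QM: "ideal_smult R M (seq_ideal R a j) = Z j" if "j \<le> r" for j using Z_eq that by blast
  have c: "colon_length R M (Z r) (Z j) (a (Suc j)) = e_ext j" if "j < r" for j
    using colon_length_clen[OF that] that by (simp add: e_ext_def)
  consider "i = 0" | "0 < i" "i < r" | "i = r" "i \<noteq> 0" using assms by linarith
  then show ?thesis
  proof cases
    case 1
    have "module_length R (quot_module M (Z r)) = len (Q 1) (carrier M)"
      using quot_module_length[OF sub_Q] by (simp add: Z_r)
    then show ?thesis
      using 1 c[of "r - 1"] seq_nonempty QM by (simp add: e_coeff_def e_ext_def)
  next
    case 2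
    then have "Suc (r - i) = r - i + 1" "Suc (r - i - 1) = r - i" by simp_all
    then show ?thesis
      using 2 c[of "r - i"] c[of "r - i - 1"] QM by (simp add: e_coeff_def)
  next
    case 3
    \<comment> \<open>The last clause of the definition is written with the zero submodule, which is
      \<open>Z 0\<close>.\<close>
    then show ?thesis
      using c[of 0] QM seq_nonempty by (simp add: e_coeff_def Z_0[symmetric])
  qed
qed

text \<open>Substituting k = r - i and summing by parts brings the polynomial into the shape of
  \<open>P 0 n\<close>.\<close>

lemma e_sum:
  "(\<Sum>i=0..r. int ((n + r - i) choose (r - i)) * e_coeff R M r a i)
    = int ((n + r) choose r) * e_ext r - (\<Sum>k<r. int ((n + k) choose Suc k) * e_ext k)"
proof -
  have "(\<Sum>i=0..r. int ((n + r - i) choose (r - i)) * e_coeff R M r a i)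
      = (\<Sum>k=0..r. int ((n + r - (r - k)) choose (r - (r - k))) * e_coeff R M r a (r - k))"
    by (subst sum.atLeastAtMost_rev) simp
  also have "\<dots> = (\<Sum>k=0..r. int ((n + k) choose k)
      * (if k = 0 then e_ext 0 else e_ext k - e_ext (k - 1)))"
  proof (rule sum.cong)
    fix k assume "k \<in> {0..r}"
    then have "n + r - (r - k) = n + k" "r - (r - k) = k" "(r - k = r) = (k = 0)"
      using seq_nonempty by auto
    then show "int ((n + r - (r - k)) choose (r - (r - k))) * e_coeff R M r a (r - k)
        = int ((n + k) choose k) * (if k = 0 then e_ext 0 else e_ext k - e_ext (k - 1))"
      using e_coeff_eq[of "r - k"] by simp
  qed simp
  also have "\<dots> = (\<Sum>k=1..r. int ((n + k) choose k) * (e_ext k - e_ext (k - 1))) + e_ext 0"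
    by (subst sum.atLeast_Suc_atMost) simp_all
  also have "\<dots> = int ((n + r) choose r) * e_ext r - (\<Sum>k<r. int ((n + k) choose Suc k) * e_ext k)"
    by (rule choose_sum_by_parts)
  finally show ?thesis .
qed

theorem length_bound:
  assumes fin: "len (Q 1) (carrier M) < \<infinity>" and noeth: "noetherian_module"
    and local: "\<And>J. maximalideal J R \<Longrightarrow> a ` {1..r} \<subseteq> J"
  defines "S \<equiv> (\<lambda>n. \<Sum>i=0..r. int ((n + r - i) choose (r - i)) * e_coeff R M r a i)"
  shows "ereal_of_enat (len (Q (Suc n)) (carrier M)) \<le> ereal (of_int (S n))"
    and "infinite {n. ereal_of_enat (len (Q (Suc n)) (carrier M)) = ereal (of_int (S n))}
      \<longleftrightarrow> absolutely_superficial R M r a"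
proof -
  \<comment> \<open>The shift by one reflects that the theorem bounds the length modulo the power
    \<open>n + 1\<close>.\<close>
  define g where "g i n = int (the_enat (hlen i (Suc n)))" for i n
  define d where "d i n = int (the_enat (dlen i n))" for i n
  \<comment> \<open>Finiteness makes \<open>the_enat\<close> faithful on all lengths involved, so
    equations in \<open>enat\<close> pass to the integers.\<close>
  have h: "hlen i n = enat (the_enat (hlen i n))" if "i \<le> r" for i n
    using hlen_finite[OF fin that, of n] by auto
  have dd: "dlen i n = enat (the_enat (dlen i n))" if "i < r" for i n
    using le_less_trans[OF dlen_le_hlen[OF that] hlen_finite[OF fin], of n] that by auto
  have cc: "clen i = enat (the_enat (clen i))" if "i < r" for i
    using le_less_trans[OF clen_le_hlen[OF that] hlen_finite[OF fin]] that by auto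
  interpret length_recursion g d e_ext "e_ext r" r
  proof
    show "g r n = e_ext r" for n by (simp add: g_def e_ext_def hlen_r)
    show "g i 0 = e_ext r" if "i \<le> r" for i using hlen_1[OF that] by (simp add: g_def e_ext_def)
    fix i n assume i: "i < r"
    have "enat (the_enat (hlen i (Suc (Suc n)))) + enat (the_enat (dlen i (Suc n)))
        = enat (the_enat (hlen i (Suc n))) + enat (the_enat (hlen (Suc i) (Suc (Suc n))))"
      using hlen_rec[OF i, of "Suc n"] h[of i] h[of "Suc i"] dd[OF i] i by simp
    then have "the_enat (hlen i (Suc (Suc n))) + the_enat (dlen i (Suc n))
        = the_enat (hlen i (Suc n)) + the_enat (hlen (Suc i) (Suc (Suc n)))"
      by simp
    then show "g i (Suc n) + d i (Suc n) = g i n + g (Suc i) (Suc n)"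
      unfolding g_def d_def by (metis of_nat_add)
    have "enat (the_enat (clen i)) \<le> enat (the_enat (dlen i (Suc n)))"
      using clen_le_dlen[OF i, of n] cc[OF i] dd[OF i, of "Suc n"] by simp
    then show "e_ext i \<le> d i (Suc n)" using i by (simp add: e_ext_def d_def)
  qed
  have SP: "S n = P 0 n" for n
    unfolding S_def e_sum P_def by (simp add: atLeast0LessThan)
  \<comment> \<open>Level 0 adds only the zero submodule, so \<open>hlen 0\<close> is the length to
    be bounded.\<close>
  have "B 0 (Suc n) = Q (Suc n)" for n
    unfolding B_def Z_0 using sub_zero[OF sub_Q] by (intro add_absorb1 sub_trivial sub_Q) simp
  then have "len (Q (Suc n)) (carrier M) = enat (the_enat (hlen 0 (Suc n)))" for n
    using h[of 0 "Suc n"] unfolding hlen_def by simp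
  then have L: "ereal_of_enat (len (Q (Suc n)) (carrier M)) = ereal (of_int (g 0 n))" for n
    by (simp add: g_def)
  show "ereal_of_enat (len (Q (Suc n)) (carrier M)) \<le> ereal (of_int (S n))"
    unfolding L SP using bound[of n] by simp
  have "d i (Suc n) = e_ext i \<longleftrightarrow> dlen i (Suc n) = clen i" if "i < r" for i n
  proof -
    obtain x y where "clen i = enat x" "dlen i (Suc n) = enat y" using cc dd \<open>i < r\<close> by blast
    then show ?thesis using \<open>i < r\<close> by (auto simp: d_def e_ext_def)
  qed
  moreover have "superficial \<longleftrightarrow> (\<forall>i<r. \<forall>n. dlen i (Suc n) = clen i)"
    by (rule superficial_iff[OF fin noeth]) (rule local)
  ultimately have "(\<forall>i<r. \<forall>n. d i (Suc n) = e_ext i) \<longleftrightarrow> superficial" by simp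
  then show "infinite {n. ereal_of_enat (len (Q (Suc n)) (carrier M)) = ereal (of_int (S n))}
      \<longleftrightarrow> absolutely_superficial R M r a"
    unfolding L SP absolutely_superficial_iff using infinite_equality_iff[OF seq_nonempty] by simp
qed

end

theorem theorem4p1:
  fixes A :: "('a, 'c) ring_scheme" and M :: "('a, 'b, 'd) module_scheme"
    and \<mm> :: "'a set" and a :: "nat \<Rightarrow> 'a" and r :: nat and q :: "'a set"
  assumes "noetherian_local_ring A \<mm>"
    and "Module.module A M"
    and "fin_gen_module A M"
    and "r \<ge> 1"
    and "system_of_parameters A \<mm> M r a"
    and "q = seq_ideal A a r"
  shows "(\<forall>n::nat.
      ereal_of_enat (module_length A (quot_module M (ideal_smult A M (q [^]\<^bsub>ideals_set A\<^esub> (n + 1)))))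
        \<le> ereal (of_int (\<Sum>i=0..r. int ((n + r - i) choose (r - i)) * e_coeff A M r a i))) \<and>
    (infinite {n::nat.
      ereal_of_enat (module_length A (quot_module M (ideal_smult A M (q [^]\<^bsub>ideals_set A\<^esub> (n + 1)))))
        = ereal (of_int (\<Sum>i=0..r. int ((n + r - i) choose (r - i)) * e_coeff A M r a i))}
      \<longleftrightarrow> absolutely_superficial A M r a)"
proof -
  interpret A: noetherian_local_ring A \<mm> by fact
  interpret module A M by fact
  have a\<mm>: "a ` {1..r} \<subseteq> \<mm>"
    using assms(5) by (auto simp: system_of_parameters_def)
  have "ideal \<mm> A" using A.maximal by (rule maximalideal.axioms(1))
  then have \<mm>A: "\<mm> \<subseteq> carrier A" by (simp add: additive_subgroup.a_subset ideal.axioms(1))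
  interpret module_sequence A M a r
    by unfold_locales (use a\<mm> \<mm>A assms(4) in auto)
  have length: "module_length A (quot_module M (ideal_smult A M (q [^]\<^bsub>ideals_set A\<^esub> (n + 1))))
      = len (Q (Suc n)) (carrier M)" for n :: nat
    unfolding assms(6) Q_eq quot_module_length[OF sub_Q] by simp
  have fin: "len (Q 1) (carrier M) < \<infinity>"
    using assms(5) quot_module_length[OF sub_Q, of 1]
    unfolding system_of_parameters_def Z_eq[OF order.refl] Z_r by simp
  have noeth: noetherian_module
    by (rule fin_gen_imp_noetherian[OF A.noetherian_ring_axioms assms(3)])
  \<comment> \<open>Uniqueness of the maximal ideal enters here: it supplies the hypothesis of
    Nakayama's lemma.\<close>
  have local: "a ` {1..r} \<subseteq> J" if "maximalideal J A" for J
    using A.unique_maximal[OF that] a\<mm> by simp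
  show ?thesis
    unfolding length using length_bound[OF fin noeth] local by simp
qed

end
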